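(* Let $F$ be a field of prime characteristic $p$. Let $\alpha,\beta\in F$ with $\alpha\neq 0$, and let $M=M_{\alpha,\beta}\in\mathfrak{gl}(p)$ be the $p\times p$ matrix over $F$ $$M_{\alpha,\beta}=\begin{pmatrix} \beta & \alpha & 0 & \dots & 0\\ 0 & \beta & 2\alpha & \dots & 0\\ \vdots & \vdots & \ddots & \ddots & \vdots\\ 0 & 0 & \dots & \beta & (p-1)\alpha\\ 0 & 0 & \dots & \dots & \beta\end{pmatrix},$$ that is, with all diagonal entries $\beta$, with $(i,i+1)$ entry $i\alpha$ for $1\le i\le p-1$, and zeros elsewhere. Let $m\geq 1$ and let $f(X)\in F[X]$ be an arbitrary monic polynomial of degree $m$. Let $C\in \mathfrak{gl}(pm)$ be the companion matrix of $f(X^p)$. Then: (1) The linear map $R:\mathfrak{h}(1)\to\mathfrak{gl}(pm)$ given by $$x_1\mapsto M\oplus\cdots\oplus M\ (m\text{ copies}),\quad y_1\mapsto C,\quad z\mapsto \alpha\cdot I$$ defines a faithful representation of $\mathfrak{h}(1)$, where $x_1$ acts with minimal polynomial $(X-\beta)^p$ and $y_1$ with minimal polynomial $f(X^p)$. (2) If $f$ is irreducible then $R$ is irreducible. (3) If $f(X)=(X-\gamma^p)^m$ for some $\gamma\in F$, then $R$ is uniserial with $m$ composition factors, all isomorphic to $V_{\alpha,\beta,\gamma}$.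
   Context: $\mathfrak{gl}(k)$ denotes the Lie algebra of $k\times k$ matrices over $F$, acting on the column space $F^k$. The Heisenberg algebra $\mathfrak{h}(1)$ over $F$ is the 3-dimensional Lie algebra with basis $x_1,y_1,z$, with $[x_1,y_1]=z$ and $z$ central. The companion matrix of a monic polynomial $X^d+c_{d-1}X^{d-1}+\cdots+c_0$ is the $d\times d$ matrix with $1$'s on the first subdiagonal, last column $(-c_0,\dots,-c_{d-1})^T$, and zeros elsewhere. $M\oplus\cdots\oplus M$ denotes the block diagonal matrix. A module is uniserial if its submodules form a chain under inclusion. For $\alpha,\beta,\gamma\in F$ with $\alpha\neq 0$, $V_{\alpha,\beta,\gamma}$ denotes the $p$-dimensional $\mathfrak{h}(1)$-module $F[X]/(X^p)$ on which $z$ acts as $\alpha\cdot I$, $x_1$ acts as $\beta\cdot I+\alpha\cdot d/dX$, and $y_1$ acts as $\gamma\cdot I$ plus multiplication by $X$ (these operators on $F[X]$ preserve $(X^p)$ since $F$ has characteristic $p$). *)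

theory Defs
  imports
    "HOL-Computational_Algebra.Computational_Algebra"
    "HOL-Algebra.AbelCoset"
    "Jordan_Normal_Form.Char_Poly"
    "Jordan_Normal_Form.VS_Connect"
begin

section \<open>Lie algebras, their homomorphisms and their modules\<close>

text \<open>Vector spaces are modules in the sense of HOL-Algebra over a ring record \<open>K\<close>; for a
  type-class field the latter is \<open>class_ring\<close>. The record fields \<open>mult\<close> and \<open>one\<close> inherited
  from \<open>ring\<close> play no role in the records below.\<close>

record ('f, 'l) lie_alg = "('f, 'l) module" +
  bracket :: "'l \<Rightarrow> 'l \<Rightarrow> 'l"

locale lie_algebra = vectorspace K L
  for K :: "('f, 'k) ring_scheme" and L :: "('f, 'l, 'c) lie_alg_scheme" +
  assumes bracket_closed:
      "\<lbrakk>x \<in> carrier L; y \<in> carrier L\<rbrakk> \<Longrightarrow> bracket L x y \<in> carrier L"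
    and bracket_add_left:
      "\<lbrakk>x \<in> carrier L; y \<in> carrier L; w \<in> carrier L\<rbrakk> \<Longrightarrow>
        bracket L (x \<oplus>\<^bsub>L\<^esub> y) w = bracket L x w \<oplus>\<^bsub>L\<^esub> bracket L y w"
    and bracket_add_right:
      "\<lbrakk>x \<in> carrier L; y \<in> carrier L; w \<in> carrier L\<rbrakk> \<Longrightarrow>
        bracket L w (x \<oplus>\<^bsub>L\<^esub> y) = bracket L w x \<oplus>\<^bsub>L\<^esub> bracket L w y"
    and bracket_smult_left:
      "\<lbrakk>a \<in> carrier K; x \<in> carrier L; y \<in> carrier L\<rbrakk> \<Longrightarrow>
        bracket L (a \<odot>\<^bsub>L\<^esub> x) y = a \<odot>\<^bsub>L\<^esub> bracket L x y"
    and bracket_smult_right: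
      "\<lbrakk>a \<in> carrier K; x \<in> carrier L; y \<in> carrier L\<rbrakk> \<Longrightarrow>
        bracket L x (a \<odot>\<^bsub>L\<^esub> y) = a \<odot>\<^bsub>L\<^esub> bracket L x y"
    and bracket_alternating: "x \<in> carrier L \<Longrightarrow> bracket L x x = \<zero>\<^bsub>L\<^esub>"
    and jacobi:
      "\<lbrakk>x \<in> carrier L; y \<in> carrier L; w \<in> carrier L\<rbrakk> \<Longrightarrow>
        bracket L x (bracket L y w) \<oplus>\<^bsub>L\<^esub> bracket L y (bracket L w x)
          \<oplus>\<^bsub>L\<^esub> bracket L w (bracket L x y) = \<zero>\<^bsub>L\<^esub>"

locale lie_algebra_hom = dom: lie_algebra K L + cod: lie_algebra K G
  for K :: "('f, 'k) ring_scheme" and L :: "('f, 'l, 'c) lie_alg_scheme"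
    and G :: "('f, 'g, 'd) lie_alg_scheme" +
  fixes h :: "'l \<Rightarrow> 'g"
  assumes linear: "h \<in> module_hom K L G"
    and hom_bracket:
      "\<lbrakk>x \<in> carrier L; y \<in> carrier L\<rbrakk> \<Longrightarrow> h (bracket L x y) = bracket G (h x) (h y)"

record ('f, 'l, 'v) lie_mod = "('f, 'v) module" +
  act :: "'l \<Rightarrow> 'v \<Rightarrow> 'v"

locale lie_module = lie_algebra K L + rep: vectorspace K M
  for K :: "('f, 'k) ring_scheme" and L :: "('f, 'l, 'c) lie_alg_scheme"
    and M :: "('f, 'l, 'v, 'd) lie_mod_scheme" +
  assumes act_closed:
      "\<lbrakk>x \<in> carrier L; v \<in> carrier M\<rbrakk> \<Longrightarrow> act M x v \<in> carrier M"
    and act_add_left: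
      "\<lbrakk>x \<in> carrier L; y \<in> carrier L; v \<in> carrier M\<rbrakk> \<Longrightarrow>
        act M (x \<oplus>\<^bsub>L\<^esub> y) v = act M x v \<oplus>\<^bsub>M\<^esub> act M y v"
    and act_add_right:
      "\<lbrakk>x \<in> carrier L; v \<in> carrier M; w \<in> carrier M\<rbrakk> \<Longrightarrow>
        act M x (v \<oplus>\<^bsub>M\<^esub> w) = act M x v \<oplus>\<^bsub>M\<^esub> act M x w"
    and act_smult_left:
      "\<lbrakk>a \<in> carrier K; x \<in> carrier L; v \<in> carrier M\<rbrakk> \<Longrightarrow>
        act M (a \<odot>\<^bsub>L\<^esub> x) v = a \<odot>\<^bsub>M\<^esub> act M x v"
    and act_smult_right:
      "\<lbrakk>a \<in> carrier K; x \<in> carrier L; v \<in> carrier M\<rbrakk> \<Longrightarrow>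
        act M x (a \<odot>\<^bsub>M\<^esub> v) = a \<odot>\<^bsub>M\<^esub> act M x v"
    and act_bracket:
      "\<lbrakk>x \<in> carrier L; y \<in> carrier L; v \<in> carrier M\<rbrakk> \<Longrightarrow>
        act M (bracket L x y) v = act M x (act M y v) \<ominus>\<^bsub>M\<^esub> act M y (act M x v)"

definition lie_submodule ::
  "('f, 'k) ring_scheme \<Rightarrow> ('f, 'l, 'c) lie_alg_scheme \<Rightarrow> 'v set \<Rightarrow>
    ('f, 'l, 'v, 'd) lie_mod_scheme \<Rightarrow> bool"
  where "lie_submodule K L W M \<longleftrightarrow>
    submodule K W M \<and> (\<forall>x \<in> carrier L. \<forall>v \<in> W. act M x v \<in> W)"

definition lie_irreducible ::
  "('f, 'k) ring_scheme \<Rightarrow> ('f, 'l, 'c) lie_alg_scheme \<Rightarrow>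
    ('f, 'l, 'v, 'd) lie_mod_scheme \<Rightarrow> bool"
  where "lie_irreducible K L M \<longleftrightarrow> lie_module K L M \<and> carrier M \<noteq> {\<zero>\<^bsub>M\<^esub>} \<and>
    (\<forall>W. lie_submodule K L W M \<longrightarrow> W = {\<zero>\<^bsub>M\<^esub>} \<or> W = carrier M)"

definition lie_uniserial ::
  "('f, 'k) ring_scheme \<Rightarrow> ('f, 'l, 'c) lie_alg_scheme \<Rightarrow>
    ('f, 'l, 'v, 'd) lie_mod_scheme \<Rightarrow> bool"
  where "lie_uniserial K L M \<longleftrightarrow> lie_module K L M \<and>
    (\<forall>U W. lie_submodule K L U M \<longrightarrow> lie_submodule K L W M \<longrightarrow> U \<subseteq> W \<or> W \<subseteq> U)"

definition lie_quot ::
  "('f, 'l, 'v, 'd) lie_mod_scheme \<Rightarrow> 'v set \<Rightarrow> ('f, 'l, 'v set) lie_mod"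
  where "lie_quot M W =
    \<lparr>carrier = a_rcosets\<^bsub>M\<^esub> W, mult = undefined, one = undefined, zero = W, add = set_add M,
     smult = (\<lambda>a X. \<Union>v \<in> X. W +>\<^bsub>M\<^esub> (a \<odot>\<^bsub>M\<^esub> v)),
     act = (\<lambda>x X. \<Union>v \<in> X. W +>\<^bsub>M\<^esub> (act M x v))\<rparr>"

definition lie_mod_isomorphic ::
  "('f, 'k) ring_scheme \<Rightarrow> ('f, 'l, 'c) lie_alg_scheme \<Rightarrow> ('f, 'l, 'v, 'd) lie_mod_scheme \<Rightarrow>
    ('f, 'l, 'w, 'e) lie_mod_scheme \<Rightarrow> bool"
  where "lie_mod_isomorphic K L M N \<longleftrightarrow>
    (\<exists>h \<in> module_hom K M N. bij_betw h (carrier M) (carrier N) \<and>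
      (\<forall>x \<in> carrier L. \<forall>v \<in> carrier M. h (act M x v) = act N x (h v)))"

text \<open>The factors of a chain \<open>W\<^sub>0, \<dots>, W\<^sub>k\<close> of submodules are \<open>W\<^sub>1/W\<^sub>0, \<dots>, W\<^sub>k/W\<^sub>k\<^sub>-\<^sub>1\<close>; the
  chain has \<open>k\<close> factors, one less than its length as a list.\<close>

definition chain_factors ::
  "('f, 'l, 'v, 'd) lie_mod_scheme \<Rightarrow> 'v set list \<Rightarrow> ('f, 'l, 'v set) lie_mod list"
  where "chain_factors M Ws =
    map (\<lambda>i. lie_quot (M\<lparr>carrier := Ws ! Suc i\<rparr>) (Ws ! i)) [0..<length Ws - 1]"

definition composition_series ::
  "('f, 'k) ring_scheme \<Rightarrow> ('f, 'l, 'c) lie_alg_scheme \<Rightarrow> ('f, 'l, 'v, 'd) lie_mod_scheme \<Rightarrow>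
    'v set list \<Rightarrow> bool"
  where "composition_series K L M Ws \<longleftrightarrow>
    Ws \<noteq> [] \<and> hd Ws = {\<zero>\<^bsub>M\<^esub>} \<and> last Ws = carrier M \<and>
    (\<forall>W \<in> set Ws. lie_submodule K L W M) \<and>
    (\<forall>i. Suc i < length Ws \<longrightarrow> Ws ! i \<subseteq> Ws ! Suc i) \<and>
    (\<forall>Q \<in> set (chain_factors M Ws). lie_irreducible K L Q)"

section \<open>Matrices\<close>

definition gl :: "nat \<Rightarrow> ('a :: field, 'a mat) lie_alg"
  where "gl n = module.extend (module_mat TYPE('a) n n) (lie_alg.fields (\<lambda>A B. A * B - B * A))"

definition rep_mod :: "nat \<Rightarrow> ('l \<Rightarrow> 'a :: field mat) \<Rightarrow> ('a, 'l, 'a vec) lie_mod"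
  where "rep_mod n R = module.extend (module_vec TYPE('a) n) (lie_mod.fields (\<lambda>x v. R x *\<^sub>v v))"

definition poly_mat :: "'a :: field poly \<Rightarrow> 'a mat \<Rightarrow> 'a mat"
  where "poly_mat q A =
    finsum (module_mat TYPE('a) (dim_row A) (dim_row A)) (\<lambda>k. coeff q k \<cdot>\<^sub>m A ^\<^sub>m k) {..degree q}"

definition is_minimal_poly :: "'a :: field mat \<Rightarrow> 'a poly \<Rightarrow> bool"
  where "is_minimal_poly A q \<longleftrightarrow> monic q \<and> poly_mat q A = 0\<^sub>m (dim_row A) (dim_row A) \<and>
    (\<forall>g. g \<noteq> 0 \<longrightarrow> poly_mat g A = 0\<^sub>m (dim_row A) (dim_row A) \<longrightarrow> degree q \<le> degree g)"

definition companion_mat :: "'a :: field poly \<Rightarrow> 'a mat"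
  where "companion_mat g = mat (degree g) (degree g) (\<lambda>(i, j).
    if Suc j = degree g then - coeff g i else if i = Suc j then 1 else 0)"

text \<open>Indices start at 0, so the entry in row \<open>i\<close> and column \<open>i + 1\<close> is \<open>(i + 1)\<alpha>\<close>.\<close>

definition M_mat :: "nat \<Rightarrow> 'a :: field \<Rightarrow> 'a \<Rightarrow> 'a mat"
  where "M_mat p \<alpha> \<beta> = mat p p (\<lambda>(i, j).
    if i = j then \<beta> else if j = Suc i then of_nat (Suc i) * \<alpha> else 0)"

section \<open>The Heisenberg algebra\<close>

text \<open>The triple \<open>(a, b, c)\<close> stands for \<open>a x\<^sub>1 + b y\<^sub>1 + c z\<close>.\<close>

definition heisenberg :: "('a :: field, 'a \<times> 'a \<times> 'a) lie_alg"
  where "heisenberg =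
    \<lparr>carrier = UNIV, mult = undefined, one = undefined, zero = (0, 0, 0),
     add = (\<lambda>(a, b, c) (a', b', c'). (a + a', b + b', c + c')),
     smult = (\<lambda>k (a, b, c). (k * a, k * b, k * c)),
     bracket = (\<lambda>(a, b, c) (a', b', c'). (0, 0, a * b' - a' * b))\<rparr>"

definition heis_x :: "'a :: field \<times> 'a \<times> 'a" where "heis_x = (1, 0, 0)"
definition heis_y :: "'a :: field \<times> 'a \<times> 'a" where "heis_y = (0, 1, 0)"
definition heis_z :: "'a :: field \<times> 'a \<times> 'a" where "heis_z = (0, 0, 1)"

text \<open>The linear map from the Heisenberg algebra to \<open>G\<close> with \<open>x\<^sub>1 \<mapsto> X\<close>, \<open>y\<^sub>1 \<mapsto> Y\<close>, \<open>z \<mapsto> Z\<close>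
  (characterised by \<open>heis_lin_unique\<close> below).\<close>

definition heis_lin ::
  "('a :: field, 'g, 'd) module_scheme \<Rightarrow> 'g \<Rightarrow> 'g \<Rightarrow> 'g \<Rightarrow> 'a \<times> 'a \<times> 'a \<Rightarrow> 'g"
  where "heis_lin G X Y Z = (\<lambda>(a, b, c). a \<odot>\<^bsub>G\<^esub> X \<oplus>\<^bsub>G\<^esub> b \<odot>\<^bsub>G\<^esub> Y \<oplus>\<^bsub>G\<^esub> c \<odot>\<^bsub>G\<^esub> Z)"

definition heis_poly_mod ::
  "'a :: field \<Rightarrow> 'a \<Rightarrow> 'a \<Rightarrow> ('a, 'a \<times> 'a \<times> 'a, 'a poly) lie_mod"
  where "heis_poly_mod \<alpha> \<beta> \<gamma> =
    \<lparr>carrier = UNIV, mult = undefined, one = undefined, zero = 0, add = (+),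
     smult = Polynomial.smult,
     act = (\<lambda>(a, b, c) g.
       Polynomial.smult a (Polynomial.smult \<beta> g + Polynomial.smult \<alpha> (pderiv g)) +
       Polynomial.smult b (Polynomial.smult \<gamma> g + [:0, 1:] * g) +
       Polynomial.smult c (Polynomial.smult \<alpha> g))\<rparr>"

text \<open>\<open>F[X]\<close> with the operators \<open>\<beta> + \<alpha> d/dX\<close>, \<open>\<gamma> + X\<close> and \<open>\<alpha>\<close> is itself a module over the
  Heisenberg algebra, so \<open>V\<^sub>\<alpha>\<^sub>,\<^sub>\<beta>\<^sub>,\<^sub>\<gamma>\<close> is its quotient by the submodule \<open>(X\<^sup>p)\<close>.\<close>

definition V_mod :: "nat \<Rightarrow> 'a :: field \<Rightarrow> 'a \<Rightarrow> 'a \<Rightarrow> ('a, 'a \<times> 'a \<times> 'a, 'a poly set) lie_mod"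
  where "V_mod p \<alpha> \<beta> \<gamma> = lie_quot (heis_poly_mod \<alpha> \<beta> \<gamma>) {g. monom 1 p dvd g}"

section \<open>Consistency of the definitions\<close>

lemma vectorspace_class_ringI:
  fixes V :: "('a :: field, 'v, 'd) module_scheme"
  assumes "abelian_group V"
    and "\<And>a x. x \<in> carrier V \<Longrightarrow> a \<odot>\<^bsub>V\<^esub> x \<in> carrier V"
    and "\<And>a b x. x \<in> carrier V \<Longrightarrow> (a + b) \<odot>\<^bsub>V\<^esub> x = a \<odot>\<^bsub>V\<^esub> x \<oplus>\<^bsub>V\<^esub> b \<odot>\<^bsub>V\<^esub> x"
    and "\<And>a x y. x \<in> carrier V \<Longrightarrow> y \<in> carrier V \<Longrightarrow>
      a \<odot>\<^bsub>V\<^esub> (x \<oplus>\<^bsub>V\<^esub> y) = a \<odot>\<^bsub>V\<^esub> x \<oplus>\<^bsub>V\<^esub> a \<odot>\<^bsub>V\<^esub> y"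
    and "\<And>a b x. x \<in> carrier V \<Longrightarrow> (a * b) \<odot>\<^bsub>V\<^esub> x = a \<odot>\<^bsub>V\<^esub> (b \<odot>\<^bsub>V\<^esub> x)"
    and "\<And>x. x \<in> carrier V \<Longrightarrow> 1 \<odot>\<^bsub>V\<^esub> x = x"
  shows "vectorspace (class_ring :: 'a ring) V"
  unfolding vectorspace_def
proof
  show "Module.module (class_ring :: 'a ring) V"
    by (rule moduleI) (use assms in \<open>auto intro: class_cring.cring_axioms\<close>)
  show "field (class_ring :: 'a ring)"
    by (rule class_field.field_axioms)
qed

lemma heisenberg_simps [simp]:
  "carrier heisenberg = UNIV"
  "zero heisenberg = (0, 0, 0)"
  "add heisenberg = (\<lambda>(a, b, c) (a', b', c'). (a + a', b + b', c + c'))"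
  "smult heisenberg = (\<lambda>k (a, b, c). (k * a, k * b, k * c))"
  "bracket heisenberg = (\<lambda>(a, b, c) (a', b', c'). (0, 0, a * b' - a' * b))"
  by (simp_all add: heisenberg_def)

lemma gl_simps [simp]:
  "carrier (gl n) = carrier_mat n n"
  "zero (gl n) = 0\<^sub>m n n"
  "add (gl n) = (+)"
  "smult (gl n) = (\<cdot>\<^sub>m)"
  "bracket (gl n) = (\<lambda>A B. A * B - B * A)"
  by (simp_all add: gl_def module_mat_def module.extend_def lie_alg.fields_def)

lemma rep_mod_simps [simp]:
  "carrier (rep_mod n R) = carrier_vec n"
  "zero (rep_mod n R) = 0\<^sub>v n"
  "add (rep_mod n R) = (+)"
  "smult (rep_mod n R) = (\<cdot>\<^sub>v)"
  "act (rep_mod n R) = (\<lambda>x v. R x *\<^sub>v v)"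
  by (simp_all add: rep_mod_def module_vec_def module.extend_def lie_mod.fields_def)

lemma lie_algebra_heisenberg: "lie_algebra (class_ring :: 'a :: field ring) heisenberg"
proof -
  have "abelian_group (heisenberg :: ('a, 'a \<times> 'a \<times> 'a) lie_alg)"
  proof (rule abelian_groupI)
    fix x :: "'a \<times> 'a \<times> 'a"
    obtain a b c where x: "x = (a, b, c)" by (cases x)
    show "\<exists>y \<in> carrier heisenberg. y \<oplus>\<^bsub>heisenberg\<^esub> x = \<zero>\<^bsub>heisenberg\<^esub>"
      by (rule bexI[of _ "(- a, - b, - c)"]) (auto simp: x)
  qed (auto simp: algebra_simps)
  then have "vectorspace (class_ring :: 'a ring) heisenberg"
    by (rule vectorspace_class_ringI) (auto simp: algebra_simps)
  then show ?thesis
    by (rule lie_algebra.intro) (unfold_locales, auto simp: algebra_simps)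
qed

lemma heis_basis_bracket:
  "bracket heisenberg heis_x heis_y = heis_z"
  "bracket heisenberg heis_z v = \<zero>\<^bsub>heisenberg\<^esub>"
  by (cases v, simp_all add: heis_x_def heis_y_def heis_z_def)+

lemma lie_algebra_gl: "lie_algebra (class_ring :: 'a :: field ring) (gl n)"
proof -
  have "abelian_group (gl n :: ('a, 'a mat) lie_alg)"
  proof (rule abelian_groupI)
    fix A :: "'a mat" assume "A \<in> carrier (gl n)"
    then show "\<exists>B \<in> carrier (gl n). B \<oplus>\<^bsub>gl n\<^esub> A = \<zero>\<^bsub>gl n\<^esub>"
      by (intro bexI[of _ "- A"]) (auto simp: uminus_l_inv_mat)
  qed (auto simp: assoc_add_mat comm_add_mat)
  then have "vectorspace (class_ring :: 'a ring) (gl n)"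
    by (rule vectorspace_class_ringI) (auto simp: algebra_simps)
  then show ?thesis
  proof (rule lie_algebra.intro, unfold_locales, goal_cases)
    case (7 x y w)
    have [simp]: "(A - B) * C = A * C - B * C" "C * (A - B) = C * A - C * B"
      if "A \<in> carrier_mat n n" "B \<in> carrier_mat n n" "C \<in> carrier_mat n n" for A B C :: "'a mat"
      using that by (simp_all add: minus_mult_distrib_mat mult_minus_distrib_mat)
    from 7 show ?case
      by (simp add: assoc_mult_mat[of _ n n _ n _ n]) (rule eq_matI, auto)
  qed (auto simp: minus_mult_distrib_mat mult_minus_distrib_mat add_mult_distrib_mat
      mult_add_distrib_mat mult_smult_distrib[of _ n n _ n] mult_smult_assoc_mat[of _ n n _ n]
      intro!: eq_matI simp: algebra_simps)
qed

lemma heis_lin_unique: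
  fixes G :: "('a :: field, 'g, 'd) module_scheme"
  assumes "vectorspace (class_ring :: 'a ring) G"
    and "X \<in> carrier G" "Y \<in> carrier G" "Z \<in> carrier G"
  shows "h \<in> module_hom (class_ring :: 'a ring) heisenberg G \<and>
      h heis_x = X \<and> h heis_y = Y \<and> h heis_z = Z \<longleftrightarrow> h = heis_lin G X Y Z"
proof -
  interpret vectorspace "class_ring :: 'a ring" G by fact
  have zero: "0 \<odot>\<^bsub>G\<^esub> v = \<zero>\<^bsub>G\<^esub>" if "v \<in> carrier G" for v
    using lmult_0[of v] that by (simp add: class_ring_simps)
  have one: "1 \<odot>\<^bsub>G\<^esub> v = v" if "v \<in> carrier G" for v
    using smult_one[of v] that by (simp add: class_ring_simps)
  have closed: "a \<odot>\<^bsub>G\<^esub> v \<in> carrier G" if "v \<in> carrier G" for a v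
    using smult_closed[of a v] that by simp
  have assoc: "(a * b) \<odot>\<^bsub>G\<^esub> v = a \<odot>\<^bsub>G\<^esub> (b \<odot>\<^bsub>G\<^esub> v)" if "v \<in> carrier G" for a b v
    using smult_assoc1[of a b v] that by simp
  have distr_l: "(a + b) \<odot>\<^bsub>G\<^esub> v = a \<odot>\<^bsub>G\<^esub> v \<oplus>\<^bsub>G\<^esub> b \<odot>\<^bsub>G\<^esub> v" if "v \<in> carrier G" for a b v
    using smult_l_distr[of a b v] that by simp
  have distr_r: "a \<odot>\<^bsub>G\<^esub> (v \<oplus>\<^bsub>G\<^esub> w) = a \<odot>\<^bsub>G\<^esub> v \<oplus>\<^bsub>G\<^esub> a \<odot>\<^bsub>G\<^esub> w"
    if "v \<in> carrier G" "w \<in> carrier G" for a v w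
    using smult_r_distr[of a v w] that by simp
  show ?thesis
  proof
    assume h: "h \<in> module_hom (class_ring :: 'a ring) heisenberg G \<and>
      h heis_x = X \<and> h heis_y = Y \<and> h heis_z = Z"
    show "h = heis_lin G X Y Z"
    proof
      fix u :: "'a \<times> 'a \<times> 'a"
      obtain a b c where u: "u = (a, b, c)" by (cases u)
      have add: "h (v \<oplus>\<^bsub>heisenberg\<^esub> w) = h v \<oplus>\<^bsub>G\<^esub> h w" for v w
        using h module_hom_add[of h "class_ring :: 'a ring" heisenberg G v w] by simp
      have smult: "h (k \<odot>\<^bsub>heisenberg\<^esub> v) = k \<odot>\<^bsub>G\<^esub> h v" for k v
        using h module_hom_smult[of h "class_ring :: 'a ring" heisenberg G k v] by simp
      have "u = a \<odot>\<^bsub>heisenberg\<^esub> heis_x \<oplus>\<^bsub>heisenberg\<^esub> b \<odot>\<^bsub>heisenberg\<^esub> heis_y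
          \<oplus>\<^bsub>heisenberg\<^esub> c \<odot>\<^bsub>heisenberg\<^esub> heis_z"
        by (simp add: u heis_x_def heis_y_def heis_z_def)
      then have "h u = a \<odot>\<^bsub>G\<^esub> h heis_x \<oplus>\<^bsub>G\<^esub> b \<odot>\<^bsub>G\<^esub> h heis_y \<oplus>\<^bsub>G\<^esub> c \<odot>\<^bsub>G\<^esub> h heis_z"
        by (simp only: add smult)
      then show "h u = heis_lin G X Y Z u"
        using h by (simp add: heis_lin_def u)
    qed
  next
    assume "h = heis_lin G X Y Z"
    then show "h \<in> module_hom (class_ring :: 'a ring) heisenberg G \<and>
      h heis_x = X \<and> h heis_y = Y \<and> h heis_z = Z"
      using assms(2-4)
      by (auto simp: module_hom_def heis_lin_def heis_x_def heis_y_def heis_z_def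
          zero one closed assoc distr_l distr_r M.add.m_ac)
  qed
qed

lemma lie_module_rep_mod:
  fixes L :: "('a :: field, 'l, 'c) lie_alg_scheme"
  assumes "lie_algebra_hom class_ring L (gl n) R"
  shows "lie_module class_ring L (rep_mod n R)"
proof -
  interpret lie_algebra_hom class_ring L "gl n" R by fact
  have R_closed: "R x \<in> carrier_mat n n" if "x \<in> carrier L" for x
    using module_hom_closed[OF linear] that by auto
  have R_add: "R (x \<oplus>\<^bsub>L\<^esub> y) = R x + R y" if "x \<in> carrier L" "y \<in> carrier L" for x y
    using module_hom_add[OF linear that] by simp
  have R_smult: "R (a \<odot>\<^bsub>L\<^esub> x) = a \<cdot>\<^sub>m R x" if "x \<in> carrier L" for a x
    using module_hom_smult[OF linear _ that, of a] by simp
  have grp: "abelian_group (rep_mod n R)"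
  proof (rule abelian_groupI)
    fix v :: "'a vec" assume "v \<in> carrier (rep_mod n R)"
    then show "\<exists>w \<in> carrier (rep_mod n R). w \<oplus>\<^bsub>rep_mod n R\<^esub> v = \<zero>\<^bsub>rep_mod n R\<^esub>"
      by (intro bexI[of _ "- v"]) auto
  qed (auto simp: comm_add_vec)
  interpret rep: abelian_group "rep_mod n R" by (rule grp)
  have minus: "v \<ominus>\<^bsub>rep_mod n R\<^esub> w = v - w" if "v \<in> carrier_vec n" "w \<in> carrier_vec n" for v w
  proof -
    have "\<ominus>\<^bsub>rep_mod n R\<^esub> w = - w"
      using that by (intro rep.minus_equality) auto
    then show ?thesis using that by (simp add: a_minus_def) auto
  qed
  have vs: "vectorspace class_ring (rep_mod n R)"
    using grp by (rule vectorspace_class_ringI)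
      (auto simp: add_smult_distrib_vec smult_add_distrib_vec smult_smult_assoc)
  have smult_mat_vec: "(a \<cdot>\<^sub>m A) *\<^sub>v v = a \<cdot>\<^sub>v (A *\<^sub>v v)"
    if "A \<in> carrier_mat n n" "v \<in> carrier_vec n" for a A and v :: "'a vec"
    using that by (intro eq_vecI) auto
  show ?thesis
  proof (rule lie_module.intro[OF dom.lie_algebra_axioms vs], rule lie_module_axioms.intro, goal_cases)
    case (6 x y v)
    have "R (bracket L x y) = R x * R y - R y * R x"
      using hom_bracket[OF 6(1,2)] by simp
    moreover have "R x * R y \<in> carrier_mat n n" "R y * R x \<in> carrier_mat n n"
      using 6 R_closed[of x] R_closed[of y] by auto
    ultimately show ?case
      using 6 R_closed[of x] R_closed[of y]
      by (simp add: minus minus_mult_distrib_mat_vec[of _ n n] assoc_mult_mat_vec[of _ n n _ n])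
  qed (auto intro: mult_mat_vec_carrier[of _ n n] simp: R_add R_smult R_closed add_mult_distrib_mat_vec[of _ n n]
      mult_add_distrib_mat_vec[of _ n n] mult_mat_vec[of _ n n] smult_mat_vec)
qed

lemma lie_module_quot:
  assumes "lie_module K L M" and W: "lie_submodule K L W M"
  shows "lie_module K L (lie_quot M W)"
proof -
  interpret lie_module K L M by fact
  have sub: "submodule K W M" and act_W: "\<And>x v. x \<in> carrier L \<Longrightarrow> v \<in> W \<Longrightarrow> act M x v \<in> W"
    using W by (auto simp: lie_submodule_def)
  interpret W: submodule K W M by (rule sub)
  have neg: "\<ominus>\<^bsub>M\<^esub> v \<in> W" if "v \<in> W" for v
  proof -
    have "\<ominus>\<^bsub>K\<^esub> \<one>\<^bsub>K\<^esub> \<in> carrier K" by simp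
    then have "(\<ominus>\<^bsub>K\<^esub> \<one>\<^bsub>K\<^esub>) \<odot>\<^bsub>M\<^esub> v \<in> W" using that by (rule W.smult_closed)
    then show ?thesis using that W.subset rep.smult_minus_1[of v] by (metis subsetD)
  qed
  have W_sub: "subgroup W (add_monoid M)"
  proof
    show "inv\<^bsub>add_monoid M\<^esub> x \<in> W" if "x \<in> W" for x
      using neg[OF that] by (simp add: a_inv_def)
  qed (use W.subset in auto)
  interpret Wg: abelian_subgroup W M
    by (rule abelian_subgroupI3)
      (auto intro: additive_subgroup.intro W_sub rep.abelian_group_axioms)
  have descend: "(\<Union>v \<in> W +>\<^bsub>M\<^esub> u. W +>\<^bsub>M\<^esub> f v) = W +>\<^bsub>M\<^esub> f u"
    if u: "u \<in> carrier M"
      and f: "\<And>v. v \<in> carrier M \<Longrightarrow> f v \<in> carrier M" "\<And>v. v \<in> W \<Longrightarrow> f v \<in> W"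
        "\<And>v w. v \<in> carrier M \<Longrightarrow> w \<in> carrier M \<Longrightarrow> f (v \<oplus>\<^bsub>M\<^esub> w) = f v \<oplus>\<^bsub>M\<^esub> f w" for f u
  proof -
    have "W +>\<^bsub>M\<^esub> f v = W +>\<^bsub>M\<^esub> f u" if v: "v \<in> W +>\<^bsub>M\<^esub> u" for v
    proof -
      obtain w where w: "w \<in> W" "v = w \<oplus>\<^bsub>M\<^esub> u"
        using v by (auto simp: a_r_coset_def')
      have wc: "w \<in> carrier M" using w W.subset by auto
      have "f v \<in> W +>\<^bsub>M\<^esub> f u"
        using w wc u f by (auto simp: a_r_coset_def')
      then show ?thesis
        using rep.a_repr_independence[of "f v" W "f u"] f u W_sub by auto
    qed
    moreover have "u \<in> W +>\<^bsub>M\<^esub> u"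
      using Wg.a_rcos_self[OF u] .
    ultimately show ?thesis by blast
  qed
  have quot_carrier: "X \<in> carrier (lie_quot M W) \<longleftrightarrow> (\<exists>u \<in> carrier M. X = W +>\<^bsub>M\<^esub> u)" for X
    by (auto simp: lie_quot_def A_RCOSETS_def')
  have quot_mem: "W +>\<^bsub>M\<^esub> u \<in> carrier (lie_quot M W)" if "u \<in> carrier M" for u
    using that by (auto simp: quot_carrier)
  have quotE: thesis
    if "X \<in> carrier (lie_quot M W)" "\<And>u. u \<in> carrier M \<Longrightarrow> X = W +>\<^bsub>M\<^esub> u \<Longrightarrow> thesis" for X thesis
    using that by (auto simp: quot_carrier)
  have quot_zero: "\<zero>\<^bsub>lie_quot M W\<^esub> = W +>\<^bsub>M\<^esub> \<zero>\<^bsub>M\<^esub>"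
    using rep.a_coset_add_zero W.subset by (simp add: lie_quot_def)
  have quot_add: "(W +>\<^bsub>M\<^esub> u) \<oplus>\<^bsub>lie_quot M W\<^esub> (W +>\<^bsub>M\<^esub> v) = W +>\<^bsub>M\<^esub> (u \<oplus>\<^bsub>M\<^esub> v)"
    if "u \<in> carrier M" "v \<in> carrier M" for u v
    using Wg.a_rcos_sum[OF that] by (simp add: lie_quot_def)
  have quot_smult: "a \<odot>\<^bsub>lie_quot M W\<^esub> (W +>\<^bsub>M\<^esub> u) = W +>\<^bsub>M\<^esub> (a \<odot>\<^bsub>M\<^esub> u)"
    if "a \<in> carrier K" "u \<in> carrier M" for a u
    unfolding lie_quot_def using that
    by simp (rule descend, auto simp: rep.smult_r_distr)
  have quot_act: "act (lie_quot M W) x (W +>\<^bsub>M\<^esub> u) = W +>\<^bsub>M\<^esub> act M x u"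
    if "x \<in> carrier L" "u \<in> carrier M" for x u
    unfolding lie_quot_def using that
    by simp (rule descend, auto simp: act_W act_closed act_add_right)
  have grp: "abelian_group (lie_quot M W)"
  proof (rule abelian_groupI)
    fix X assume "X \<in> carrier (lie_quot M W)"
    then obtain u where "u \<in> carrier M" "X = W +>\<^bsub>M\<^esub> u" by (auto elim!: quotE simp: quot_mem)
    then show "\<exists>Y \<in> carrier (lie_quot M W). Y \<oplus>\<^bsub>lie_quot M W\<^esub> X = \<zero>\<^bsub>lie_quot M W\<^esub>"
      by (intro bexI[of _ "W +>\<^bsub>M\<^esub> (\<ominus>\<^bsub>M\<^esub> u)"])
        (auto elim!: quotE simp: quot_mem quot_add quot_zero rep.l_neg)
  qed (auto elim!: quotE simp: quot_mem quot_add quot_zero rep.M.add.m_ac)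
  interpret Q: abelian_group "lie_quot M W" by (rule grp)
  have quot_minus: "(W +>\<^bsub>M\<^esub> u) \<ominus>\<^bsub>lie_quot M W\<^esub> (W +>\<^bsub>M\<^esub> v) = W +>\<^bsub>M\<^esub> (u \<ominus>\<^bsub>M\<^esub> v)"
    if "u \<in> carrier M" "v \<in> carrier M" for u v
  proof -
    have "\<ominus>\<^bsub>lie_quot M W\<^esub> (W +>\<^bsub>M\<^esub> v) = W +>\<^bsub>M\<^esub> (\<ominus>\<^bsub>M\<^esub> v)"
      using that by (intro Q.minus_equality)
        (auto elim!: quotE simp: quot_mem quot_add quot_zero rep.l_neg)
    then show ?thesis using that by (simp add: a_minus_def quot_add)
  qed
  have "Module.module K (lie_quot M W)"
    by (rule moduleI[OF R.is_cring grp])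
      (auto elim!: quotE simp: quot_mem quot_add quot_smult rep.smult_l_distr
        rep.smult_r_distr rep.smult_assoc1)
  then have vs: "vectorspace K (lie_quot M W)"
    by (simp add: vectorspace_def field_axioms)
  show ?thesis
    by (rule lie_module.intro[OF lie_algebra_axioms vs], rule lie_module_axioms.intro)
      (auto elim!: quotE simp: quot_mem quot_add quot_smult quot_act quot_minus act_closed act_add_left
        act_add_right act_smult_left act_smult_right act_bracket bracket_closed)
qed

lemma lie_module_heis_poly_mod:
  "lie_module (class_ring :: 'a :: field ring) heisenberg (heis_poly_mod \<alpha> \<beta> \<gamma>)"
proof -
  let ?P = "heis_poly_mod \<alpha> \<beta> \<gamma>"
  have grp: "abelian_group ?P"
  proof (rule abelian_groupI)
    fix g :: "'a poly"
    show "\<exists>h \<in> carrier ?P. h \<oplus>\<^bsub>?P\<^esub> g = \<zero>\<^bsub>?P\<^esub>"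
      by (rule bexI[of _ "- g"]) (auto simp: heis_poly_mod_def)
  qed (auto simp: heis_poly_mod_def)
  interpret P: abelian_group ?P by (rule grp)
  have minus: "g \<ominus>\<^bsub>?P\<^esub> h = g - h" for g h
  proof -
    have "\<ominus>\<^bsub>?P\<^esub> h = - h"
      by (intro P.minus_equality) (auto simp: heis_poly_mod_def)
    then show ?thesis by (simp add: a_minus_def) (simp add: heis_poly_mod_def)
  qed
  have vs: "vectorspace class_ring ?P"
    using grp by (rule vectorspace_class_ringI)
      (auto simp: heis_poly_mod_def smult_add_left smult_add_right)
  show ?thesis
  proof (rule lie_module.intro[OF lie_algebra_heisenberg vs], rule lie_module_axioms.intro, goal_cases)
    case (6 x y v)
    obtain a b c a' b' c' where "x = (a, b, c)" "y = (a', b', c')" by (cases x, cases y)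
    then show ?case unfolding minus
      by (simp add: heis_poly_mod_def pderiv_add pderiv_smult pderiv_mult pderiv_pCons
          smult_add_right smult_diff_right algebra_simps smult_add_left smult_diff_left)
  qed (auto simp: heis_poly_mod_def pderiv_add pderiv_smult smult_add_left smult_add_right algebra_simps)
qed

lemma lie_module_V_mod:
  assumes "CHAR('a :: field) = p"
  shows "lie_module (class_ring :: 'a ring) heisenberg (V_mod p \<alpha> \<beta> \<gamma>)"
proof -
  let ?W = "{g :: 'a poly. monom 1 p dvd g}"
  have "monom 1 p dvd pderiv g" if dvd: "monom 1 p dvd g" for g :: "'a poly"
  proof -
    obtain q where "g = monom 1 p * q" using dvd by (rule dvdE)
    moreover have "pderiv (monom 1 p :: 'a poly) = 0"
      using assms by (auto simp: pderiv_monom)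
    ultimately show ?thesis by (simp add: pderiv_mult)
  qed
  then have "\<forall>x \<in> carrier heisenberg. \<forall>g \<in> ?W. act (heis_poly_mod \<alpha> \<beta> \<gamma>) x g \<in> ?W"
    by (simp add: heis_poly_mod_def del: mult_pCons_left) (intro allI impI dvd_add dvd_smult dvd_mult; simp)
  moreover interpret lie_module "class_ring :: 'a ring" heisenberg "heis_poly_mod \<alpha> \<beta> \<gamma>"
    by (rule lie_module_heis_poly_mod)
  have "submodule (class_ring :: 'a ring) ?W (heis_poly_mod \<alpha> \<beta> \<gamma>)"
    by (rule submodule.intro[OF rep.module_axioms])
      (auto simp: heis_poly_mod_def intro: dvd_add dvd_smult)
  ultimately have "lie_submodule (class_ring :: 'a ring) heisenberg ?W (heis_poly_mod \<alpha> \<beta> \<gamma>)"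
    by (simp add: lie_submodule_def)
  then show ?thesis
    unfolding V_mod_def by (intro lie_module_quot lie_module_heis_poly_mod)
qed

end

theory Submission
  imports Defs
begin

text \<open>Writing \<open>h = f(X\<^sup>p)\<close>, the column space is \<open>F[X]/(h)\<close> in the basis of the powers of \<open>X\<close>:
  the companion matrix is multiplication by \<open>X\<close>, and since the coefficient \<open>(i + 1)\<alpha>\<close> vanishes
  whenever \<open>p\<close> divides \<open>i + 1\<close>, the block diagonal matrix is a single \<open>M\<close> of size \<open>pm\<close>, which is
  \<open>\<beta> + \<alpha> d/dX\<close>; the derivative descends to the quotient because \<open>h' = 0\<close>. Thus \<open>R\<close> is a quotient
  of the Heisenberg module \<open>F[X]\<close>. A submodule of \<open>F[X]\<close> is an ideal \<open>(d)\<close> closed under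
  derivation, and \<open>d\<close> divides \<open>d'\<close> only if \<open>d' = 0\<close>, that is, if \<open>d = u(X\<^sup>p)\<close>. Submodules of \<open>R\<close>
  therefore correspond to divisors \<open>u\<close> of \<open>f\<close>. If \<open>f = (X - \<gamma>\<^sup>p)\<^sup>m\<close>, they are generated by the
  \<open>(X - \<gamma>)\<^sup>p\<^sup>k\<close> and form a chain, and multiplication by \<open>(X - \<gamma>)\<^sup>p\<^sup>k\<close> after the substitution
  \<open>X \<mapsto> X - \<gamma>\<close> identifies \<open>V\<^sub>\<alpha>\<^sub>,\<^sub>\<beta>\<^sub>,\<^sub>\<gamma>\<close> with each factor.\<close>

section \<open>Homomorphisms, quotients and chains of Lie modules\<close>

lemma lie_submoduleD:
  assumes "lie_submodule K L W M"
  shows "Module.module K M" "W \<subseteq> carrier M" "\<zero>\<^bsub>M\<^esub> \<in> W"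
    and "\<And>v w. v \<in> W \<Longrightarrow> w \<in> W \<Longrightarrow> v \<oplus>\<^bsub>M\<^esub> w \<in> W"
    and "\<And>a v. a \<in> carrier K \<Longrightarrow> v \<in> W \<Longrightarrow> a \<odot>\<^bsub>M\<^esub> v \<in> W"
    and "\<And>x v. x \<in> carrier L \<Longrightarrow> v \<in> W \<Longrightarrow> act M x v \<in> W"
  using assms by (auto simp: lie_submodule_def submodule_def)

text \<open>\<open>submodule\<close> asks for closure under sums and scalars but not under negation,
  which is scaling by -1.\<close>

lemma lie_submodule_a_inv_closed:
  assumes "lie_submodule K L W M" "v \<in> W"
  shows "\<ominus>\<^bsub>M\<^esub> v \<in> W"
proof -
  note W = lie_submoduleD[OF assms(1)]
  interpret Module.module K M by (rule W)
  have "(\<ominus>\<^bsub>K\<^esub> \<one>\<^bsub>K\<^esub>) \<odot>\<^bsub>M\<^esub> v \<in> W" using W(5)[of "\<ominus>\<^bsub>K\<^esub> \<one>\<^bsub>K\<^esub>" v] assms by simp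
  then show ?thesis using smult_minus_1[of v] assms(2) W(2) by (metis subsetD)
qed

text \<open>Opens the coset lemmas about \<open>abelian_subgroup\<close> for use with
  \<open>lie_quot\<close>.\<close>

lemma lie_submodule_abelian_subgroup:
  assumes "lie_submodule K L W M"
  shows "abelian_subgroup W M"
proof -
  note W = lie_submoduleD[OF assms]
  interpret Module.module K M by (rule W)
  have "subgroup W (add_monoid M)"
  proof
    show "inv\<^bsub>add_monoid M\<^esub> x \<in> W" if "x \<in> W" for x
      using lie_submodule_a_inv_closed[OF assms that] by (simp add: a_inv_def)
  qed (use W in auto)
  then show ?thesis
    by (intro abelian_subgroupI3 additive_subgroup.intro abelian_group_axioms)
qed

context lie_module
begin

lemma act_zero: "act M x \<zero>\<^bsub>M\<^esub> = \<zero>\<^bsub>M\<^esub>" if "x \<in> carrier L"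
  using act_smult_right[of "\<zero>\<^bsub>K\<^esub>" x "\<zero>\<^bsub>M\<^esub>"] act_closed[OF that] that by simp

lemma lie_submodule_zero: "lie_submodule K L {\<zero>\<^bsub>M\<^esub>} M"
  unfolding lie_submodule_def
  by (auto intro!: submodule.intro rep.module_axioms act_zero)

lemma lie_module_restrict:
  assumes B: "lie_submodule K L B M"
  shows "lie_module K L (M\<lparr>carrier := B\<rparr>)"
proof -
  note Bd = lie_submoduleD[OF B]
  have mod: "Module.module K (M\<lparr>carrier := B\<rparr>)"
    using B by (intro rep.submodule_is_module) (simp add: lie_submodule_def)
  interpret B: Module.module K "M\<lparr>carrier := B\<rparr>" by (rule mod)
  \<comment> \<open>Additive inverses are picked from the carrier of the record, so after shrinking
    the carrier they must be compared with those of \<open>M\<close>.\<close>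
  have "\<ominus>\<^bsub>M\<lparr>carrier := B\<rparr>\<^esub> w = \<ominus>\<^bsub>M\<^esub> w" if "w \<in> B" for w
    using that Bd(2) lie_submodule_a_inv_closed[OF B that]
    by (intro B.minus_equality) (auto simp: rep.l_neg)
  then have minus: "v \<ominus>\<^bsub>M\<lparr>carrier := B\<rparr>\<^esub> w = v \<ominus>\<^bsub>M\<^esub> w" if "w \<in> B" for v w
    using that by (simp add: a_minus_def)
  show ?thesis
    by (rule lie_module.intro[OF lie_algebra_axioms], rule vectorspace.intro[OF mod field_axioms],
        rule lie_module_axioms.intro)
      (use Bd in \<open>auto simp: subset_iff minus act_add_left act_add_right act_smult_left
        act_smult_right act_bracket\<close>)
qed

lemma lie_submodule_restrict_iff:
  assumes B: "lie_submodule K L B M"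
  shows "lie_submodule K L W (M\<lparr>carrier := B\<rparr>) \<longleftrightarrow> lie_submodule K L W M \<and> W \<subseteq> B"
proof -
  interpret B: lie_module K L "M\<lparr>carrier := B\<rparr>" by (rule lie_module_restrict[OF B])
  show ?thesis
    using lie_submoduleD(2)[OF B] rep.module_axioms B.rep.module_axioms
    by (auto simp: lie_submodule_def submodule_def)
qed

end

section \<open>Homomorphisms and the correspondence of submodules\<close>

locale lie_module_hom = dom: lie_module K L M + cod: lie_module K L N
  for K :: "('f, 'k) ring_scheme" and L :: "('f, 'l, 'c) lie_alg_scheme"
    and M :: "('f, 'l, 'v, 'd) lie_mod_scheme" and N :: "('f, 'l, 'w, 'e) lie_mod_scheme" +
  fixes h :: "'v \<Rightarrow> 'w"
  assumes linear: "h \<in> module_hom K M N"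
    and hom_act: "\<lbrakk>x \<in> carrier L; v \<in> carrier M\<rbrakk> \<Longrightarrow> h (act M x v) = act N x (h v)"
begin

sublocale lin: mod_hom K M N h
  by (intro mod_hom.intro mod_hom_axioms.intro dom.rep.module_axioms cod.rep.module_axioms linear)

lemma lie_submodule_vimage:
  assumes "lie_submodule K L W N"
  shows "lie_submodule K L {v \<in> carrier M. h v \<in> W} M"
  unfolding lie_submodule_def using lie_submoduleD[OF assms]
  by (auto intro!: submodule.intro dom.rep.module_axioms simp: hom_act dom.act_closed)

lemma lie_submodule_image:
  assumes "lie_submodule K L W M"
  shows "lie_submodule K L (h ` W) N"
proof -
  note W = lie_submoduleD[OF assms]
  have "\<zero>\<^bsub>N\<^esub> \<in> h ` W" using W(3) lin.f0_is_0 by (metis imageI)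
  moreover have "h v \<oplus>\<^bsub>N\<^esub> h w \<in> h ` W" if "v \<in> W" "w \<in> W" for v w
    using W(4)[OF that] that W(2) by (auto simp: subset_iff simp flip: lin.f_add)
  moreover have "a \<odot>\<^bsub>N\<^esub> h v \<in> h ` W" if "a \<in> carrier K" "v \<in> W" for a v
    using W(5)[OF that] that W(2) by (auto simp: subset_iff simp flip: lin.f_smult)
  moreover have "act N x (h v) \<in> h ` W" if "x \<in> carrier L" "v \<in> W" for x v
    using W(6)[OF that] that W(2) by (auto simp: subset_iff simp flip: hom_act)
  ultimately show ?thesis
    unfolding lie_submodule_def using W(2)
    by (auto intro!: submodule.intro cod.rep.module_axioms)
qed

lemma lie_submodule_ker: "lie_submodule K L lin.ker M"
  using lie_submodule_vimage[OF cod.lie_submodule_zero] by (simp add: lin.ker_def)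

lemma eq_iff_diff_in_ker:
  assumes "v \<in> carrier M" "w \<in> carrier M"
  shows "h v = h w \<longleftrightarrow> v \<ominus>\<^bsub>M\<^esub> w \<in> lin.ker"
proof -
  have "h v = h w \<longleftrightarrow> h v \<ominus>\<^bsub>N\<^esub> h w = \<zero>\<^bsub>N\<^esub>"
  proof
    assume "h v \<ominus>\<^bsub>N\<^esub> h w = \<zero>\<^bsub>N\<^esub>"
    then have "\<ominus>\<^bsub>N\<^esub> (\<ominus>\<^bsub>N\<^esub> h w) = h v"
      using assms by (intro cod.rep.minus_equality) (auto simp: a_minus_def)
    then show "h v = h w" using assms by simp
  qed (use assms in \<open>simp add: a_minus_def cod.rep.r_neg\<close>)
  then show ?thesis using assms by (simp add: lin.ker_def)
qed

text \<open>Two elements with the same image differ by an element of the kernel, and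
  \<open>W\<close> contains the kernel. This is the nontrivial half of the correspondence between
  submodules of the image and submodules above the kernel.\<close>

lemma vimage_image_eq:
  assumes W: "lie_submodule K L W M" and "lin.ker \<subseteq> W"
  shows "{v \<in> carrier M. h v \<in> h ` W} = W"
proof (intro equalityI subsetI)
  fix v assume "v \<in> {v \<in> carrier M. h v \<in> h ` W}"
  then obtain w where v: "v \<in> carrier M" "w \<in> W" "h v = h w" by auto
  with lie_submoduleD(2)[OF W] have w: "w \<in> carrier M" by auto
  have "v \<ominus>\<^bsub>M\<^esub> w \<in> W" using eq_iff_diff_in_ker[of v w] v w assms(2) by auto
  moreover have "v = (v \<ominus>\<^bsub>M\<^esub> w) \<oplus>\<^bsub>M\<^esub> w"
    using v w by (simp add: a_minus_def dom.rep.a_assoc dom.rep.l_neg)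
  ultimately show "v \<in> W" using lie_submoduleD(4)[OF W _ v(2)] by metis
qed (use lie_submoduleD(2)[OF W] in auto)

text \<open>Correspondence theorem: along a surjection, preimages match the submodules of
  \<open>N\<close> with the submodules of \<open>M\<close> above the kernel, so irreducibility of
  \<open>N\<close> can be tested inside \<open>M\<close>.\<close>

lemma lie_irreducible_iff:
  assumes surj: "h ` carrier M = carrier N"
  shows "lie_irreducible K L N \<longleftrightarrow> lin.ker \<noteq> carrier M \<and>
    (\<forall>W. lie_submodule K L W M \<longrightarrow> lin.ker \<subseteq> W \<longrightarrow> W = lin.ker \<or> W = carrier M)"
    (is "?L \<longleftrightarrow> ?ne \<and> ?R")
proof -
  have "carrier N \<noteq> {\<zero>\<^bsub>N\<^esub>} \<longleftrightarrow> ?ne"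
  proof
    assume "carrier N \<noteq> {\<zero>\<^bsub>N\<^esub>}"
    then obtain w where w: "w \<in> carrier N" "w \<noteq> \<zero>\<^bsub>N\<^esub>" using cod.rep.zero_closed by fast
    then obtain v where "v \<in> carrier M" "w = h v" unfolding surj[symmetric] by (elim imageE)
    with w have "v \<in> carrier M" "v \<notin> lin.ker" by (simp_all add: lin.ker_def)
    then show ?ne by metis
  next
    assume ?ne
    then obtain v where "v \<in> carrier M" "h v \<noteq> \<zero>\<^bsub>N\<^esub>" unfolding lin.ker_def by fast
    then show "carrier N \<noteq> {\<zero>\<^bsub>N\<^esub>}" using lin.f_im[of v] by fast
  qed
  moreover have "(\<forall>W. lie_submodule K L W N \<longrightarrow> W = {\<zero>\<^bsub>N\<^esub>} \<or> W = carrier N) \<longleftrightarrow> ?R"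
  proof (intro iffI allI impI)
    fix W assume N: "\<forall>W. lie_submodule K L W N \<longrightarrow> W = {\<zero>\<^bsub>N\<^esub>} \<or> W = carrier N"
      and W: "lie_submodule K L W M" "lin.ker \<subseteq> W"
    have "h ` W = {\<zero>\<^bsub>N\<^esub>} \<or> h ` W = carrier N"
      using N lie_submodule_image[OF W(1)] by blast
    then show "W = lin.ker \<or> W = carrier M"
      using vimage_image_eq[OF W] by (auto simp: lin.ker_def)
  next
    fix W assume M: ?R and W: "lie_submodule K L W N"
    have "lin.ker \<subseteq> {v \<in> carrier M. h v \<in> W}"
      using lie_submoduleD(3)[OF W] by (auto simp: lin.ker_def)
    then have "{v \<in> carrier M. h v \<in> W} = lin.ker \<or> {v \<in> carrier M. h v \<in> W} = carrier M"
      using M lie_submodule_vimage[OF W] by blast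
    moreover have "h ` {v \<in> carrier M. h v \<in> W} = W"
      using lie_submoduleD(2)[OF W] surj by auto
    moreover have "h ` lin.ker = {\<zero>\<^bsub>N\<^esub>}"
      unfolding lin.ker_def using imageI[of "\<zero>\<^bsub>M\<^esub>" "{v \<in> carrier M. h v = \<zero>\<^bsub>N\<^esub>}" h] by auto
    ultimately show "W = {\<zero>\<^bsub>N\<^esub>} \<or> W = carrier N" unfolding surj[symmetric] by (elim disjE) simp_all
  qed
  ultimately show ?thesis
    unfolding lie_irreducible_def using cod.lie_module_axioms by blast
qed

end

section \<open>The projection onto a quotient\<close>

lemma lie_module_hom_quot:
  assumes "lie_module K L M" and A: "lie_submodule K L A M"
  shows "lie_module_hom K L M (lie_quot M A) (\<lambda>u. A +>\<^bsub>M\<^esub> u)"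
proof -
  interpret lie_module K L M by fact
  interpret Q: lie_module K L "lie_quot M A" by (rule lie_module_quot[OF assms])
  interpret A: abelian_subgroup A M by (rule lie_submodule_abelian_subgroup[OF A])
  note Ad = lie_submoduleD[OF A]
  \<comment> \<open>\<open>lie_quot\<close> defines scaling and action as a union over all
    representatives of a coset. As \<open>f\<close> is additive and maps \<open>A\<close> into
    itself, the sets in this union all agree, so one representative suffices.\<close>
  have descend: "A +>\<^bsub>M\<^esub> f u = (\<Union>v \<in> A +>\<^bsub>M\<^esub> u. A +>\<^bsub>M\<^esub> f v)"
    if u: "u \<in> carrier M"
      and f: "\<And>v. v \<in> carrier M \<Longrightarrow> f v \<in> carrier M" "\<And>v. v \<in> A \<Longrightarrow> f v \<in> A"
        "\<And>v w. v \<in> carrier M \<Longrightarrow> w \<in> carrier M \<Longrightarrow> f (v \<oplus>\<^bsub>M\<^esub> w) = f v \<oplus>\<^bsub>M\<^esub> f w" for f u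
  proof -
    have "A +>\<^bsub>M\<^esub> f v = A +>\<^bsub>M\<^esub> f u" if "v \<in> A +>\<^bsub>M\<^esub> u" for v
    proof -
      obtain w where w: "w \<in> A" "v = w \<oplus>\<^bsub>M\<^esub> u" using \<open>v \<in> A +>\<^bsub>M\<^esub> u\<close> by (auto simp: a_r_coset_def')
      have "f v \<in> A +>\<^bsub>M\<^esub> f u"
        using w u f Ad(2) by (auto simp: a_r_coset_def')
      then show ?thesis
        using rep.a_repr_independence[of "f v" A "f u"] f u A.a_subgroup by auto
    qed
    then show ?thesis using A.a_rcos_self[OF u] by blast
  qed
  have "(\<lambda>u. A +>\<^bsub>M\<^esub> u) \<in> module_hom K M (lie_quot M A)"
    unfolding module_hom_def
  proof (intro CollectI conjI allI impI funcsetI)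
    fix a u assume "a \<in> carrier K \<and> u \<in> carrier M"
    then show "A +>\<^bsub>M\<^esub> (a \<odot>\<^bsub>M\<^esub> u) = a \<odot>\<^bsub>lie_quot M A\<^esub> (A +>\<^bsub>M\<^esub> u)"
      unfolding lie_quot_def by simp (rule descend, auto simp: Ad rep.smult_r_distr)
  qed (auto simp: lie_quot_def A_RCOSETS_def' A.a_rcos_sum)
  moreover have "A +>\<^bsub>M\<^esub> act M x u = act (lie_quot M A) x (A +>\<^bsub>M\<^esub> u)"
    if "x \<in> carrier L" "u \<in> carrier M" for x u
    unfolding lie_quot_def using that
    by simp (rule descend, auto simp: Ad act_closed act_add_right)
  ultimately show ?thesis
    by unfold_locales
qed

lemma carrier_lie_quot: "carrier (lie_quot M A) = (\<lambda>u. A +>\<^bsub>M\<^esub> u) ` carrier M"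
  by (auto simp: lie_quot_def A_RCOSETS_def')

lemma ker_lie_quot:
  assumes "lie_module K L M" and A: "lie_submodule K L A M"
  shows "mod_hom.ker M (lie_quot M A) (\<lambda>u. A +>\<^bsub>M\<^esub> u) = A"
proof -
  interpret lie_module_hom K L M "lie_quot M A" "\<lambda>u. A +>\<^bsub>M\<^esub> u"
    by (rule lie_module_hom_quot[OF assms])
  interpret A: abelian_subgroup A M by (rule lie_submodule_abelian_subgroup[OF A])
  have "A +>\<^bsub>M\<^esub> u = A \<longleftrightarrow> u \<in> A" if "u \<in> carrier M" for u
    using that A.a_rcos_self[of u] A.a_rcos_const[of u] by auto
  then show ?thesis
    using lie_submoduleD(2)[OF A] by (auto simp: lin.ker_def) (auto simp: lie_quot_def)
qed

text \<open>Correspondence theorem for the projection of \<open>B\<close>, taken as a module of its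
  own; its submodules are the submodules of \<open>M\<close> inside \<open>B\<close>.\<close>

lemma lie_irreducible_quot_iff:
  assumes "lie_module K L M" and B: "lie_submodule K L B M" and A: "lie_submodule K L A M"
    and "A \<subseteq> B"
  shows "lie_irreducible K L (lie_quot (M\<lparr>carrier := B\<rparr>) A) \<longleftrightarrow> A \<noteq> B \<and>
    (\<forall>W. lie_submodule K L W M \<longrightarrow> A \<subseteq> W \<longrightarrow> W \<subseteq> B \<longrightarrow> W = A \<or> W = B)"
proof -
  interpret lie_module K L M by fact
  let ?B = "M\<lparr>carrier := B\<rparr>"
  have B': "lie_module K L ?B" by (rule lie_module_restrict[OF B])
  have A': "lie_submodule K L A ?B" using lie_submodule_restrict_iff[OF B] A assms(4) by simp
  interpret Q: lie_module_hom K L ?B "lie_quot ?B A" "\<lambda>u. A +>\<^bsub>?B\<^esub> u"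
    by (rule lie_module_hom_quot[OF B' A'])
  show ?thesis
    using Q.lie_irreducible_iff carrier_lie_quot[of ?B A]
    unfolding ker_lie_quot[OF B' A'] lie_submodule_restrict_iff[OF B] by auto
qed

section \<open>The first isomorphism theorem\<close>

context lie_module_hom
begin

lemma coset_ker:
  assumes "u \<in> carrier M"
  shows "lin.ker +>\<^bsub>M\<^esub> u = {v \<in> carrier M. h v = h u}"
proof (intro equalityI subsetI)
  fix v assume "v \<in> lin.ker +>\<^bsub>M\<^esub> u"
  then show "v \<in> {v \<in> carrier M. h v = h u}"
    using assms by (auto simp: a_r_coset_def' lin.ker_def)
next
  fix v assume v: "v \<in> {v \<in> carrier M. h v = h u}"
  then have "v \<ominus>\<^bsub>M\<^esub> u \<in> lin.ker" using eq_iff_diff_in_ker[of v u] assms by auto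
  moreover have "v = (v \<ominus>\<^bsub>M\<^esub> u) \<oplus>\<^bsub>M\<^esub> u"
    using v assms by (simp add: a_minus_def dom.rep.a_assoc dom.rep.l_neg)
  ultimately show "v \<in> lin.ker +>\<^bsub>M\<^esub> u" by (auto simp: a_r_coset_def')
qed

text \<open>First isomorphism theorem, directed from the image to the quotient. Elements of the
  quotient are cosets of the kernel, that is, fibres of \<open>h\<close>, so the isomorphism
  \<open>k\<close> sends a point to its fibre.\<close>

lemma lie_mod_isomorphic_quot_ker:
  assumes surj: "h ` carrier M = carrier N"
  shows "lie_mod_isomorphic K L N (lie_quot M lin.ker)"
proof -
  let ?Q = "lie_quot M lin.ker" and ?\<pi> = "\<lambda>u. lin.ker +>\<^bsub>M\<^esub> u"
  interpret Q: lie_module_hom K L M ?Q ?\<pi>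
    by (rule lie_module_hom_quot[OF dom.lie_module_axioms lie_submodule_ker])
  define k where "k w = {v \<in> carrier M. h v = w}" for w
  have k: "k (h u) = ?\<pi> u" if "u \<in> carrier M" for u
    using coset_ker[OF that] by (simp add: k_def)
  have N: thesis if "w \<in> carrier N" "\<And>u. u \<in> carrier M \<Longrightarrow> w = h u \<Longrightarrow> thesis" for w thesis
    using that surj by blast
  have "k \<in> module_hom K N ?Q"
    unfolding module_hom_def
    by (auto elim!: N simp: k simp flip: lin.f_add lin.f_smult)
  moreover have "inj_on k (carrier N)"
    by (intro inj_onI) (auto elim!: N simp: k_def)
  moreover have "k ` carrier N = carrier ?Q"
    unfolding carrier_lie_quot surj[symmetric] image_image using k by simp
  moreover have "k (act N x w) = act ?Q x (k w)" if "x \<in> carrier L" "w \<in> carrier N" for x w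
    using that by (auto elim!: N simp: k dom.act_closed Q.hom_act simp flip: hom_act)
  ultimately show ?thesis
    unfolding lie_mod_isomorphic_def bij_betw_def by blast
qed

end

lemma lie_module_hom_restrict:
  assumes "lie_module_hom K L M N h" and B: "lie_submodule K L B N" and "h ` carrier M \<subseteq> B"
  shows "lie_module_hom K L M (N\<lparr>carrier := B\<rparr>) h"
proof -
  interpret lie_module_hom K L M N h by fact
  interpret B: lie_module K L "N\<lparr>carrier := B\<rparr>" by (rule cod.lie_module_restrict[OF B])
  show ?thesis
    using assms(3) by unfold_locales (auto simp: module_hom_def hom_act)
qed

lemma lie_module_hom_comp:
  assumes "lie_module_hom K L M N g" "lie_module_hom K L N P h"
  shows "lie_module_hom K L M P (h \<circ> g)"
proof -
  interpret g: lie_module_hom K L M N g by fact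
  interpret h: lie_module_hom K L N P h by fact
  show ?thesis
    by unfold_locales (auto simp: module_hom_def g.hom_act h.hom_act)
qed

section \<open>Modules whose submodules form a finite chain\<close>

text \<open>Isolates the lattice-theoretic side of the uniserial case: once the submodules are
  indexed in order, irreducible factors and composition series become statements about
  indices.\<close>

locale lie_module_chain = lie_module K L M
  for K :: "('f, 'k) ring_scheme" and L :: "('f, 'l, 'c) lie_alg_scheme"
    and M :: "('f, 'l, 'v, 'd) lie_mod_scheme" +
  fixes S :: "nat \<Rightarrow> 'v set" and m :: nat
  assumes lie_submodule_iff: "lie_submodule K L W M \<longleftrightarrow> (\<exists>i\<le>m. W = S i)"
    and subset_iff: "\<lbrakk>i \<le> m; j \<le> m\<rbrakk> \<Longrightarrow> S i \<subseteq> S j \<longleftrightarrow> i \<le> j"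
    and S_0: "S 0 = {\<zero>\<^bsub>M\<^esub>}"
    and S_m: "S m = carrier M"
begin

lemma eq_iff: "\<lbrakk>i \<le> m; j \<le> m\<rbrakk> \<Longrightarrow> S i = S j \<longleftrightarrow> i = j"
  using subset_iff by (metis order_antisym order_refl)

lemma lie_uniserial: "lie_uniserial K L M"
  unfolding lie_uniserial_def lie_submodule_iff
  using lie_module_axioms subset_iff by (metis nat_le_linear)

lemma lie_irreducible_quot_iff_Suc:
  assumes "i \<le> j" "j \<le> m"
  shows "lie_irreducible K L (lie_quot (M\<lparr>carrier := S j\<rparr>) (S i)) \<longleftrightarrow> j = Suc i"
proof -
  have i: "i \<le> m" using assms by simp
  have "lie_irreducible K L (lie_quot (M\<lparr>carrier := S j\<rparr>) (S i)) \<longleftrightarrow>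
      S i \<noteq> S j \<and> (\<forall>W. (\<exists>k\<le>m. W = S k) \<longrightarrow> S i \<subseteq> W \<longrightarrow> W \<subseteq> S j \<longrightarrow> W = S i \<or> W = S j)"
    unfolding lie_submodule_iff[symmetric]
  proof (rule lie_irreducible_quot_iff[OF lie_module_axioms])
    show "lie_submodule K L (S j) M" "lie_submodule K L (S i) M"
      unfolding lie_submodule_iff using assms i by blast+
  qed (use assms i in \<open>simp add: subset_iff\<close>)
  also have "\<dots> \<longleftrightarrow> S i \<noteq> S j \<and>
      (\<forall>k\<le>m. S i \<subseteq> S k \<longrightarrow> S k \<subseteq> S j \<longrightarrow> S k = S i \<or> S k = S j)" by fast
  also have "\<dots> \<longleftrightarrow> i \<noteq> j \<and> (\<forall>k\<le>m. i \<le> k \<longrightarrow> k \<le> j \<longrightarrow> k = i \<or> k = j)"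
    using assms i by (simp add: subset_iff eq_iff)
  also have "\<dots> \<longleftrightarrow> j = Suc i"
    \<comment> \<open>If \<open>i < j\<close>, then \<open>Suc i\<close> lies in the interval,
      differs from \<open>i\<close> and hence must be \<open>j\<close>.\<close>
    using assms by (auto dest!: spec[of _ "Suc i"])
  finally show ?thesis .
qed

text \<open>The terms of a series have indices in the chain. An irreducible factor forces the index
  to rise by exactly one, and the series starts at index 0 and ends at \<open>m\<close>, so there is
  only one series.\<close>

lemma composition_series_iff: "composition_series K L M Ws \<longleftrightarrow> Ws = map S [0..<Suc m]"
proof
  assume Ws: "composition_series K L M Ws"
  then have ne: "Ws \<noteq> []" by (simp add: composition_series_def)
  have "\<forall>i. i < length Ws \<longrightarrow> (\<exists>j\<le>m. Ws ! i = S j)"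
    using Ws by (auto simp: composition_series_def lie_submodule_iff)
  then obtain a where a: "a i \<le> m" "Ws ! i = S (a i)" if "i < length Ws" for i by metis
  have step: "a (Suc i) = Suc (a i)" if "Suc i < length Ws" for i
  proof -
    have "Ws ! i \<subseteq> Ws ! Suc i"
      using Ws that by (simp add: composition_series_def)
    then have "a i \<le> a (Suc i)" using a[of i] a[of "Suc i"] subset_iff that by auto
    moreover have "lie_irreducible K L (lie_quot (M\<lparr>carrier := Ws ! Suc i\<rparr>) (Ws ! i))"
      using Ws that by (auto simp: composition_series_def chain_factors_def)
    ultimately show ?thesis
      using a[of i] a[of "Suc i"] that lie_irreducible_quot_iff_Suc[of "a i" "a (Suc i)"] by auto
  qed
  have "hd Ws = S 0" using Ws by (simp add: composition_series_def S_0)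
  then have "a 0 = 0" using a[of 0] ne eq_iff[of "a 0" 0] by (simp add: hd_conv_nth)
  have ai: "a i = i" if "i < length Ws" for i
    using that by (induction i) (simp_all add: \<open>a 0 = 0\<close> step)
  have "last Ws = S m" using Ws by (simp add: composition_series_def S_m)
  moreover obtain n where n: "length Ws = Suc n" using ne by (cases Ws) auto
  then have "last Ws = S n" "n \<le> m"
    using a[of n] ai[of n] by (simp_all add: last_conv_nth ne)
  ultimately have "length Ws = Suc m" using eq_iff[of n m] n by simp
  then show "Ws = map S [0..<Suc m]"
    using a ai by (intro nth_equalityI) (simp_all del: upt_Suc)
next
  assume Ws: "Ws = map S [0..<Suc m]"
  then have len: "length Ws = Suc m" by simp
  have nth: "Ws ! i = S i" if "i \<le> m" for i
    using that unfolding Ws by (simp add: nth_append del: upt_Suc)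
  have "Ws \<noteq> []" using len by auto
  moreover have "hd Ws = {\<zero>\<^bsub>M\<^esub>}" "last Ws = carrier M"
    using \<open>Ws \<noteq> []\<close> len nth[of 0] nth[of m] by (simp_all add: hd_conv_nth last_conv_nth S_0 S_m)
  moreover have "\<forall>W \<in> set Ws. lie_submodule K L W M"
    unfolding Ws lie_submodule_iff by (auto simp: less_Suc_eq_le simp del: upt_Suc)
  moreover have "\<forall>i. Suc i < length Ws \<longrightarrow> Ws ! i \<subseteq> Ws ! Suc i"
    using len by (simp add: nth subset_iff)
  moreover have "\<forall>Q \<in> set (chain_factors M Ws). lie_irreducible K L Q"
    using len by (auto simp: chain_factors_def nth lie_irreducible_quot_iff_Suc)
  ultimately show "composition_series K L M Ws"
    unfolding composition_series_def by blast
qed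

end

section \<open>Polynomials in characteristic \<open>p\<close>\<close>

lemma coeff_pcompose_monom_1:
  fixes u :: "'a :: comm_semiring_1 poly"
  assumes "p > 0"
  shows "coeff (u \<circ>\<^sub>p monom 1 p) n = (if p dvd n then coeff u (n div p) else 0)"
proof (induction u arbitrary: n)
  case (pCons a u)
  have "p dvd n - p \<longleftrightarrow> p dvd n" if "p \<le> n"
    using that by (simp add: dvd_minus_self)
  moreover have "n div p = Suc ((n - p) div p)" if "p \<le> n"
    using that assms by (simp add: le_div_geq)
  moreover have "p dvd n \<longleftrightarrow> n = 0" if "n < p"
    using that by (auto dest: dvd_imp_le)
  ultimately show ?case
    using assms by (cases "n < p") (auto simp: pcompose_pCons coeff_monom_mult pCons.IH coeff_pCons split: nat.splits)
qed simp

lemma monic_pcompose_monom: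
  fixes f :: "'a :: field poly"
  assumes "p > 0" "monic f"
  shows "monic (f \<circ>\<^sub>p monom 1 p)"
  using assms by (simp add: degree_pcompose degree_monom_eq coeff_pcompose_monom_1)

lemma pderiv_monom_CHAR: "CHAR('a :: field) = p \<Longrightarrow> pderiv (monom (1 :: 'a) p) = 0"
  by (auto simp: pderiv_monom)

lemma pderiv_pcompose_monom_CHAR:
  fixes u :: "'a :: field poly"
  shows "CHAR('a) = p \<Longrightarrow> pderiv (u \<circ>\<^sub>p monom 1 p) = 0"
  by (simp add: pderiv_pcompose pderiv_monom_CHAR)

text \<open>The factor \<open>p * k\<close> produced by the power rule is zero in the field.\<close>

lemma pderiv_power_CHAR_mult:
  fixes q :: "'a :: field poly"
  assumes "CHAR('a) = p"
  shows "pderiv (q ^ (p * k)) = 0"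
proof (cases "p * k")
  case 0
  show ?thesis by (simp only: 0 power_0 pderiv_1)
next
  case (Suc l)
  have "of_nat (Suc l) = (0 :: 'a)"
    unfolding Suc[symmetric] using assms by (simp add: of_nat_eq_0_iff_char_dvd)
  then show ?thesis unfolding Suc by (simp only: pderiv_power_Suc) simp
qed

text \<open>A vanishing derivative means that n times the n-th coefficient is zero for every n, so
  only coefficients at multiples of \<open>p\<close> survive.\<close>

lemma pderiv_eq_0_CHARE:
  fixes d :: "'a :: field poly"
  assumes "pderiv d = 0" "CHAR('a) = p" "p > 0"
  obtains u where "d = u \<circ>\<^sub>p monom 1 p"
proof
  \<comment> \<open>The list may run past the degree of \<open>u\<close>; the surplus entries are
    zero coefficients of \<open>d\<close>.\<close>
  define u where "u = Poly (map (\<lambda>k. coeff d (p * k)) [0..<Suc (degree d)])"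
  have u: "coeff u k = coeff d (p * k)" for k
  proof (cases "k \<le> degree d")
    case False
    then have "degree d < p * k" using assms(3)
      by (metis leI le_trans mult_le_mono1 nat_mult_1 not_less Suc_leI One_nat_def)
    then show ?thesis using False
      by (simp add: u_def nth_default_def coeff_eq_0 del: upt_Suc)
  qed (simp add: u_def nth_default_def del: upt_Suc)
  show "d = u \<circ>\<^sub>p monom 1 p"
  proof (rule poly_eqI)
    fix n
    have "coeff d n = 0" if "\<not> p dvd n"
    proof (cases n)
      case (Suc k)
      have "of_nat n * coeff d n = coeff (pderiv d) k"
        by (simp only: Suc coeff_pderiv)
      then have "of_nat n * coeff d n = 0" using assms(1) by simp
      moreover have "of_nat n \<noteq> (0 :: 'a)"
        using that assms(2) by (simp add: of_nat_eq_0_iff_char_dvd)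
      ultimately show ?thesis by simp
    qed (use that in simp)
    then show "coeff d n = coeff (u \<circ>\<^sub>p monom 1 p) n"
      by (simp add: coeff_pcompose_monom_1 assms(3) u)
  qed
qed

text \<open>Substitute X^p into the division of \<open>f\<close> by \<open>u\<close>: the remainder
  still has smaller degree than the divisor, both degrees being scaled by \<open>p\<close>, so it is
  divisible only if it is zero.\<close>

lemma pcompose_monom_dvd_iff:
  fixes u f :: "'a :: field poly"
  assumes "p > 0"
  shows "u \<circ>\<^sub>p monom 1 p dvd f \<circ>\<^sub>p monom 1 p \<longleftrightarrow> u dvd f"
proof
  assume dvd: "u \<circ>\<^sub>p monom 1 p dvd f \<circ>\<^sub>p monom 1 p"
  have "f \<circ>\<^sub>p monom 1 p = (f div u) \<circ>\<^sub>p monom 1 p * u \<circ>\<^sub>p monom 1 p + (f mod u) \<circ>\<^sub>p monom 1 p"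
    by (simp flip: pcompose_mult pcompose_add)
  then have dvd_mod: "u \<circ>\<^sub>p monom 1 p dvd (f mod u) \<circ>\<^sub>p monom 1 p"
    using dvd by (metis dvd_add_right_iff dvd_triv_right)
  have "f mod u = 0"
  proof (rule ccontr)
    assume nz: "f mod u \<noteq> 0"
    then have nz': "(f mod u) \<circ>\<^sub>p monom 1 p \<noteq> 0"
      using assms by (simp add: pcompose_eq_0_iff degree_monom_eq)
    have "u \<noteq> 0" using dvd_mod nz' by auto
    then have "degree (f mod u) < degree u" using nz by (rule degree_mod_less')
    moreover have "degree u * p \<le> degree (f mod u) * p"
      using dvd_imp_degree_le[OF dvd_mod nz'] by (simp add: degree_pcompose degree_monom_eq)
    ultimately show False using assms by simp
  qed
  then show "u dvd f" by auto
next
  assume "u dvd f"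
  then show "u \<circ>\<^sub>p monom 1 p dvd f \<circ>\<^sub>p monom 1 p"
    by (auto simp: pcompose_mult elim!: dvdE)
qed

text \<open>The n-th coefficient of the p-th derivative carries the product (n+1)...(n+p) of
  \<open>p\<close> consecutive integers, which is divisible by p! and therefore by
  \<open>p\<close>.\<close>

lemma higher_pderiv_CHAR:
  fixes g :: "'a :: field poly"
  assumes "CHAR('a) = p" "prime p"
  shows "(pderiv ^^ p) g = 0"
proof (rule poly_eqI)
  fix n
  have "p dvd fact p"
    using assms(2) by (simp add: prime_dvd_fact_iff)
  then have "int p dvd int (fact p)" by (simp only: of_nat_dvd_iff)
  then have "int p dvd fact p" by simp
  also have "fact p dvd pochhammer (int (Suc n)) p" by (rule fact_dvd_pochhammer)
  finally have "p dvd pochhammer (Suc n) p"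
    by (simp only: pochhammer_of_nat of_nat_dvd_iff)
  then have "pochhammer (of_nat (Suc n)) p = (0 :: 'a)"
    unfolding pochhammer_of_nat of_nat_eq_0_iff_char_dvd assms(1) .
  then show "coeff ((pderiv ^^ p) g) n = coeff 0 n" by (simp add: coeff_higher_pderiv)
qed

text \<open>Induction on the exponent: \<open>c\<close> is a root of \<open>d\<close> or of its
  cofactor, and either way one linear factor cancels.\<close>

lemma dvd_linear_power:
  fixes d :: "'a :: field poly"
  assumes "d dvd [:- c, 1:] ^ n"
  obtains k a where "k \<le> n" "a \<noteq> 0" "d = Polynomial.smult a ([:- c, 1:] ^ k)"
  using assms
proof (induction n arbitrary: d thesis)
  case 0
  then have "d dvd 1" by simp
  then obtain a where "d = [:a:]" "a dvd 1" unfolding is_unit_poly_iff by (elim exE conjE)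
  then have "d = [:a:]" "a \<noteq> 0" by auto
  then show ?case using 0(1)[of 0 a] by simp
next
  case (Suc n)
  have "d dvd [:- c, 1:] * [:- c, 1:] ^ n" using Suc.prems(2) by (simp only: power_Suc)
  then obtain e where e: "[:- c, 1:] * [:- c, 1:] ^ n = d * e" by (elim dvdE)
  have "poly d c * poly e c = poly ([:- c, 1:] * [:- c, 1:] ^ n) c"
    by (simp only: e poly_mult)
  then have "poly d c * poly e c = 0" by simp
  then consider "poly d c = 0" | "poly e c = 0" by fastforce
  then show ?case
  proof cases
    case 1
    then obtain d' where d': "d = [:- c, 1:] * d'" by (auto simp: poly_eq_0_iff_dvd elim: dvdE)
    then have "[:- c, 1:] * [:- c, 1:] ^ n = [:- c, 1:] * (d' * e)" using e by (simp only: mult.assoc)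
    then have "d' dvd [:- c, 1:] ^ n" by (metis dvd_triv_left mult_cancel_left pCons_eq_0_iff one_neq_zero)
    then obtain k a where "k \<le> n" "a \<noteq> 0" "d' = Polynomial.smult a ([:- c, 1:] ^ k)"
      by (rule Suc.IH[rotated])
    then show ?thesis using Suc.prems(1)[of "Suc k" a] d' by simp
  next
    case 2
    then obtain e' where e': "e = [:- c, 1:] * e'" by (auto simp: poly_eq_0_iff_dvd elim: dvdE)
    then have "[:- c, 1:] * [:- c, 1:] ^ n = [:- c, 1:] * (d * e')" using e by (simp only: mult.left_commute)
    then have "d dvd [:- c, 1:] ^ n" by (metis dvd_triv_left mult_cancel_left pCons_eq_0_iff one_neq_zero)
    then obtain k a where "k \<le> n" "a \<noteq> 0" "d = Polynomial.smult a ([:- c, 1:] ^ k)"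
      by (rule Suc.IH[rotated])
    then show ?thesis using Suc.prems(1)[of k a] by simp
  qed
qed

section \<open>Polynomials evaluated at operators on F[X]\<close>

text \<open>This is q(T) applied to \<open>g\<close>, the counterpart of \<open>poly_mat\<close>. It
  lets minimal polynomials of matrices be computed with differential operators.\<close>

definition poly_op :: "('a :: field poly \<Rightarrow> 'a poly) \<Rightarrow> 'a poly \<Rightarrow> 'a poly \<Rightarrow> 'a poly"
  where "poly_op T q g = (\<Sum>k\<le>degree q. Polynomial.smult (coeff q k) ((T ^^ k) g))"

lemma poly_op_eq_sum:
  assumes "degree q \<le> n"
  shows "poly_op T q g = (\<Sum>k\<le>n. Polynomial.smult (coeff q k) ((T ^^ k) g))"
  unfolding poly_op_def using assms
  by (intro sum.mono_neutral_left) (auto simp: coeff_eq_0)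

lemma poly_op_0 [simp]: "poly_op T 0 g = 0"
  by (simp add: poly_op_def)

lemma poly_op_add: "poly_op T (q + r) g = poly_op T q g + poly_op T r g"
proof -
  define n where "n = max (degree q) (degree r)"
  have "degree (q + r) \<le> n" "degree q \<le> n" "degree r \<le> n"
    by (auto simp: n_def degree_add_le_max)
  then show ?thesis
    by (simp add: poly_op_eq_sum[of _ n] smult_add_left sum.distrib)
qed

lemma poly_op_smult: "poly_op T (Polynomial.smult c q) g = Polynomial.smult c (poly_op T q g)"
  by (simp add: poly_op_eq_sum[of _ "degree q"] degree_smult_le smult_sum2)

text \<open>Splitting off the innermost \<open>T\<close> keeps the recursion valid for every map
  \<open>T\<close>, linear or not.\<close>

lemma poly_op_pCons: "poly_op T (pCons a q) g = Polynomial.smult a g + poly_op T q (T g)"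
  by (simp add: poly_op_eq_sum[of _ "Suc (degree q)"] degree_pCons_le poly_op_def[of T q]
      sum.atMost_Suc_shift funpow_swap1 del: sum.atMost_Suc)

lemma poly_op_mult_X: "poly_op (\<lambda>g. [:0, 1:] * g) q g = q * g"
proof (induction q arbitrary: g)
  case (pCons a q)
  have "poly_op (\<lambda>g. [:0, 1:] * g) (pCons a q) g = Polynomial.smult a g + q * ([:0, 1:] * g)"
    by (simp only: poly_op_pCons pCons.IH)
  then show ?case by simp
qed simp

text \<open>Substituting X - \<beta> into the polynomial shifts the operator by \<beta>. This
  reduces \<beta> + \<alpha> d/dX to \<alpha> d/dX.\<close>

lemma poly_op_pcompose_linear:
  fixes T :: "'a :: field poly \<Rightarrow> 'a poly"
  assumes add: "\<And>g h. T (g + h) = T g + T h"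
    and smult: "\<And>c g. T (Polynomial.smult c g) = Polynomial.smult c (T g)"
  shows "poly_op T (r \<circ>\<^sub>p [:- \<beta>, 1:]) g = poly_op (\<lambda>g. T g - Polynomial.smult \<beta> g) r g"
proof (induction r arbitrary: g)
  case (pCons a r)
  let ?s = "r \<circ>\<^sub>p [:- \<beta>, 1:]"
  have pow_add: "(T ^^ k) (g + h) = (T ^^ k) g + (T ^^ k) h" for k g h
    by (induction k) (simp_all add: add)
  have pow_smult: "(T ^^ k) (Polynomial.smult c g) = Polynomial.smult c ((T ^^ k) g)" for k c g
    by (induction k) (simp_all add: smult)
  have op_add: "poly_op T q (g + h) = poly_op T q g + poly_op T q h" for q g h
    by (simp add: poly_op_def pow_add smult_add_right sum.distrib)
  have op_smult: "poly_op T q (Polynomial.smult c g) = Polynomial.smult c (poly_op T q g)" for q c g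
    by (simp add: poly_op_def pow_smult smult_sum2 mult.commute)
  have "pCons a r \<circ>\<^sub>p [:- \<beta>, 1:] = pCons a ?s + Polynomial.smult (- \<beta>) ?s"
    by (simp add: pcompose_pCons)
  then have "poly_op T (pCons a r \<circ>\<^sub>p [:- \<beta>, 1:]) g =
      Polynomial.smult a g + poly_op T ?s (T g) + Polynomial.smult (- \<beta>) (poly_op T ?s g)"
    by (simp only: poly_op_add poly_op_smult poly_op_pCons)
  also have "\<dots> = Polynomial.smult a g + poly_op T ?s (T g + Polynomial.smult (- \<beta>) g)"
    by (simp only: op_add op_smult add.assoc)
  finally show ?case
    by (simp add: pCons.IH poly_op_pCons)
qed simp

lemma funpow_smult_pderiv:
  "((\<lambda>g. Polynomial.smult \<alpha> (pderiv g)) ^^ k) g = Polynomial.smult (\<alpha> ^ k) ((pderiv ^^ k) g)"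
  for g :: "'a :: field poly"
  by (induction k) (simp_all add: pderiv_smult mult.commute)

text \<open>On X^k, derivatives of order above \<open>k\<close> vanish, and those of order below
  \<open>k\<close> have coefficient zero in \<open>r\<close>; only the k-th term is left. With
  \<open>k\<close> the lowest index in \<open>r\<close>, the constant obtained can witness that
  \<open>r\<close> does not annihilate the operator.\<close>

lemma poly_op_smult_pderiv_lowest:
  fixes r :: "'a :: field poly"
  assumes "\<And>i. i < k \<Longrightarrow> coeff r i = 0"
  shows "poly_op (\<lambda>g. Polynomial.smult \<alpha> (pderiv g)) r (monom 1 k) = [:coeff r k * \<alpha> ^ k * of_nat (fact k):]"
proof -
  have poch: "pochhammer 1 k = (of_nat (fact k) :: 'a)"
    using pochhammer_of_nat[of 1 k, where 'a = 'a] by (simp add: pochhammer_fact)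
  have *: "(pderiv ^^ i) (monom (1 :: 'a) k) = (if i = k then [:of_nat (fact k):] else 0)" if "k \<le> i" for i
  proof (rule poly_eqI)
    fix n
    show "coeff ((pderiv ^^ i) (monom (1 :: 'a) k)) n = coeff (if i = k then [:of_nat (fact k):] else 0) n"
      using that by (auto simp: coeff_higher_pderiv coeff_pCons poch split: nat.splits)
  qed
  have "poly_op (\<lambda>g. Polynomial.smult \<alpha> (pderiv g)) r (monom 1 k) =
      (\<Sum>i\<le>max k (degree r). Polynomial.smult (coeff r i * \<alpha> ^ i) ((pderiv ^^ i) (monom 1 k)))"
    by (simp add: poly_op_eq_sum[of _ "max k (degree r)"] funpow_smult_pderiv)
  also have "\<dots> = (\<Sum>i\<le>max k (degree r). if i = k then [:coeff r k * \<alpha> ^ k * of_nat (fact k):] else 0)"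
  proof (intro sum.cong refl)
    show "Polynomial.smult (coeff r i * \<alpha> ^ i) ((pderiv ^^ i) (monom 1 k)) =
        (if i = k then [:coeff r k * \<alpha> ^ k * of_nat (fact k):] else 0)" for i
      using assms[of i] *[of i] by (cases "i < k") auto
  qed
  finally show ?thesis by simp
qed

section \<open>Matrices acting on residues of polynomials\<close>

text \<open>Coordinates of the class of \<open>g\<close> in F[X]/(h) with respect to the basis 1, X,
  X^2, ...\<close>

definition residue_vec :: "'a :: field poly \<Rightarrow> 'a poly \<Rightarrow> 'a vec"
  where "residue_vec h g = vec (degree h) (coeff (g mod h))"

lemma residue_vec_carrier [simp]: "residue_vec h g \<in> carrier_vec (degree h)"
  by (simp add: residue_vec_def)

lemma residue_vec_add: "residue_vec h (g + g') = residue_vec h g + residue_vec h g'"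
  by (auto simp: residue_vec_def poly_mod_add_left)

lemma residue_vec_smult: "residue_vec h (Polynomial.smult c g) = c \<cdot>\<^sub>v residue_vec h g"
  by (auto simp: residue_vec_def mod_smult_left)

lemma residue_vec_0: "residue_vec h 0 = 0\<^sub>v (degree h)"
  by (auto simp: residue_vec_def)

lemma degree_mod_less_pos: "degree h > 0 \<Longrightarrow> degree (g mod h) < degree h"
  for h :: "'a :: field poly"
  using degree_mod_less[of h g] by (cases "h = 0") auto

lemma residue_vec_eq_0_iff:
  assumes "degree h > 0"
  shows "residue_vec h g = 0\<^sub>v (degree h) \<longleftrightarrow> h dvd g"
proof
  assume z: "residue_vec h g = 0\<^sub>v (degree h)"
  have "coeff (g mod h) i = 0" if "i < degree h" for i
    using arg_cong[OF z, of "\<lambda>v. vec_index v i"] that by (simp add: residue_vec_def)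
  then have "g mod h = 0"
    using degree_mod_less_pos[OF assms, of g] by (metis leading_coeff_0_iff)
  then show "h dvd g" by auto
qed (auto simp: residue_vec_def)

lemma residue_vec_surj:
  assumes "degree h > 0" "v \<in> carrier_vec (degree h)"
  obtains g where "v = residue_vec h g"
proof
  let ?g = "Poly (list_of_vec v)"
  have "degree ?g < degree h"
    using assms by (intro degree_lessI) (auto simp: nth_default_def)
  then show "v = residue_vec h ?g"
    using assms by (intro eq_vecI) (auto simp: residue_vec_def mod_poly_less nth_default_def)
qed

text \<open>Multiplying a remainder by X can overshoot the permitted degree by one. Subtracting its
  top coefficient \<open>coeff r d\<close> times the monic \<open>h\<close> repairs this, and that
  correction is the last column of the matrix.\<close>

lemma companion_mat_mult_residue_vec:
  fixes h :: "'a :: field poly"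
  assumes "monic h" "degree h > 0"
  shows "companion_mat h *\<^sub>v residue_vec h g = residue_vec h ([:0, 1:] * g)"
proof (rule eq_vecI)
  fix i assume "i < dim_vec (residue_vec h ([:0, 1:] * g))"
  then have i: "i < degree h" by (simp add: residue_vec_def)
  define r where "r = g mod h"
  define d where "d = degree h - 1"
  have d: "degree h = Suc d" using assms(2) by (simp add: d_def)
  have "h \<noteq> 0" using assms by auto
  have "(companion_mat h *\<^sub>v residue_vec h g) $ i =
      (\<Sum>j = 0..<Suc d. (if j = d then - coeff h i else if i = Suc j then 1 else 0) * coeff r j)"
    using i by (auto simp: companion_mat_def residue_vec_def scalar_prod_def r_def d intro!: sum.cong)
  also have "\<dots> = - coeff h i * coeff r d + (\<Sum>j = 0..<d. if Suc j = i then coeff r j else 0)"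
    by (auto intro!: sum.cong)
  also have "(\<Sum>j = 0..<d. if Suc j = i then coeff r j else 0) = coeff (pCons 0 r) i"
    using i by (cases i) (auto simp: d)
  finally have "(companion_mat h *\<^sub>v residue_vec h g) $ i = coeff (pCons 0 r) i - coeff h i * coeff r d"
    by simp
  moreover have "([:0, 1:] * g) mod h = pCons 0 r - Polynomial.smult (coeff r d) h"
    using mod_pCons[OF \<open>h \<noteq> 0\<close>, of 0 g] assms(1) by (simp add: r_def d)
  ultimately show "(companion_mat h *\<^sub>v residue_vec h g) $ i = residue_vec h ([:0, 1:] * g) $ i"
    using i by (simp add: residue_vec_def)
qed (simp add: companion_mat_def residue_vec_def)

text \<open>Because h' = 0, differentiation maps multiples of \<open>h\<close> to multiples of
  \<open>h\<close>. So it acts on residues, and the residue of g' is the derivative of the residue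
  of \<open>g\<close>.\<close>

lemma M_mat_mult_residue_vec:
  fixes h :: "'a :: field poly"
  assumes "pderiv h = 0" "degree h > 0"
  shows "M_mat (degree h) \<alpha> \<beta> *\<^sub>v residue_vec h g =
    residue_vec h (Polynomial.smult \<beta> g + Polynomial.smult \<alpha> (pderiv g))"
proof (rule eq_vecI)
  let ?n = "degree h"
  fix i assume "i < dim_vec (residue_vec h (Polynomial.smult \<beta> g + Polynomial.smult \<alpha> (pderiv g)))"
  then have i: "i < ?n" by (simp add: residue_vec_def)
  define r where "r = g mod h"
  have deg: "degree r < ?n" using degree_mod_less_pos[OF assms(2)] by (simp add: r_def)
  have "pderiv g = pderiv (g div h * h + r)" by (simp add: r_def)
  then have "pderiv g = pderiv (g div h) * h + pderiv r"
    by (simp only: pderiv_add pderiv_mult assms(1)) simp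
  moreover have "degree (pderiv r) < ?n" using deg degree_pderiv_le[of r] by simp
  ultimately have pderiv_mod: "pderiv g mod h = pderiv r"
    by (simp add: mod_poly_less poly_mod_add_left)
  have "(M_mat ?n \<alpha> \<beta> *\<^sub>v residue_vec h g) $ i =
      (\<Sum>j = 0..<?n. (if i = j then \<beta> else if j = Suc i then of_nat (Suc i) * \<alpha> else 0) * coeff r j)"
    using i by (auto simp: M_mat_def residue_vec_def scalar_prod_def r_def intro!: sum.cong)
  also have "\<dots> = (\<Sum>j = 0..<?n. (if j = i then \<beta> * coeff r i else 0) +
      (if j = Suc i then of_nat (Suc i) * \<alpha> * coeff r (Suc i) else 0))"
    by (rule sum.cong) auto
  also have "\<dots> = \<beta> * coeff r i + of_nat (Suc i) * \<alpha> * coeff r (Suc i)"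
  \<comment> \<open>In the last row no index \<open>j\<close> equals \<open>Suc i\<close>, but there
    \<open>coeff r (Suc i)\<close> is zero as well.\<close>
  proof (cases "Suc i < ?n")
    case False
    then have "coeff r (Suc i) = 0" using deg by (simp add: coeff_eq_0)
    then show ?thesis using i by (simp add: sum.distrib)
  qed (use i in \<open>simp add: sum.distrib\<close>)
  also have "\<dots> = coeff (Polynomial.smult \<beta> r + Polynomial.smult \<alpha> (pderiv r)) i"
    by (simp add: coeff_pderiv)
  finally show "(M_mat ?n \<alpha> \<beta> *\<^sub>v residue_vec h g) $ i =
      residue_vec h (Polynomial.smult \<beta> g + Polynomial.smult \<alpha> (pderiv g)) $ i"
    using i by (simp add: residue_vec_def poly_mod_add_left mod_smult_left pderiv_mod r_def)
qed (simp add: M_mat_def residue_vec_def)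

text \<open>Splitting off the first block, the entry that would link it to the rest has the factor
  \<open>p\<close> and vanishes. In the remaining blocks row numbers shift by \<open>p\<close>,
  which changes nothing in characteristic \<open>p\<close>.\<close>

lemma diag_block_M_mat:
  fixes \<alpha> \<beta> :: "'a :: field"
  assumes "CHAR('a) = p" "p > 0"
  shows "diag_block_mat (replicate m (M_mat p \<alpha> \<beta>)) = M_mat (p * m) \<alpha> \<beta>"
proof (induction m)
  case (Suc m)
  have z: "of_nat p = (0 :: 'a)" using assms(1) by (simp add: of_nat_eq_0_iff_char_dvd)
  have sub: "of_nat (k - p) = (of_nat k :: 'a)" if "p \<le> k" for k
    using that z by (metis add.right_neutral le_add_diff_inverse2 of_nat_add)
  \<comment> \<open>The premises single out \<open>i = p - 1\<close>, the last row of the first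
    block.\<close>
  have step: "1 + of_nat i = (0 :: 'a)" if "i < p" "\<not> Suc i < p" for i
    using that z by (metis Suc_lessI of_nat_Suc)
  have "four_block_mat (M_mat p \<alpha> \<beta>) (0\<^sub>m p (p * m)) (0\<^sub>m (p * m) p) (M_mat (p * m) \<alpha> \<beta>) =
      M_mat (p * Suc m) \<alpha> \<beta>"
    using assms(2) by (cases "m = 0"; intro eq_matI) (auto simp: M_mat_def z sub step Suc_diff_le)
  then show ?case
    unfolding replicate_Suc diag_block_mat.simps Let_def Suc.IH
    by (simp add: M_mat_def)
qed (auto simp: M_mat_def)

lemma mat_eqI_mult_vec:
  fixes A B :: "'a :: comm_semiring_1 mat"
  assumes A: "A \<in> carrier_mat n n" and B: "B \<in> carrier_mat n n"
    and eq: "\<And>v. v \<in> carrier_vec n \<Longrightarrow> A *\<^sub>v v = B *\<^sub>v v"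
  shows "A = B"
proof (rule eq_matI)
  fix i j assume "i < dim_row B" "j < dim_col B"
  then have ij: "i < n" "j < n" using B by auto
  have "(A *\<^sub>v unit_vec n j) $ i = (B *\<^sub>v unit_vec n j) $ i" by (simp add: eq)
  then show "A $$ (i, j) = B $$ (i, j)" using A B ij by simp
qed (use A B in auto)

lemma mat_eqI_residue_vec:
  assumes "degree h > 0"
    and "A \<in> carrier_mat (degree h) (degree h)" "B \<in> carrier_mat (degree h) (degree h)"
    and "\<And>g. A *\<^sub>v residue_vec h g = B *\<^sub>v residue_vec h g"
  shows "A = B"
  using assms(2,3) by (rule mat_eqI_mult_vec) (metis assms(1,4) residue_vec_surj)

lemma smult_mat_mult_vec:
  "A \<in> carrier_mat n k \<Longrightarrow> v \<in> carrier_vec k \<Longrightarrow> (c \<cdot>\<^sub>m A) *\<^sub>v v = c \<cdot>\<^sub>v (A *\<^sub>v v)"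
  for A :: "'a :: comm_semiring_1 mat"
  by (intro eq_vecI) auto

lemma zero_mat_mult_vec: "v \<in> carrier_vec k \<Longrightarrow> 0\<^sub>m n k *\<^sub>v v = 0\<^sub>v n"
  by (intro eq_vecI) auto

lemma poly_mat_carrier:
  assumes A: "A \<in> carrier_mat n n"
  shows "poly_mat q A \<in> carrier_mat n n"
proof -
  interpret abelian_group "module_mat TYPE('a) n n" by (rule abelian_group_mat)
  show ?thesis
    using A finsum_closed[of "\<lambda>k. coeff q k \<cdot>\<^sub>m A ^\<^sub>m k" "{..degree q}"]
    by (simp add: poly_mat_def module_mat_simps)
qed

lemma poly_mat_mult_residue_vec:
  fixes A :: "'a :: field mat"
  assumes A: "A \<in> carrier_mat (degree h) (degree h)"
    and T: "\<And>g. A *\<^sub>v residue_vec h g = residue_vec h (T g)"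
  shows "poly_mat q A *\<^sub>v residue_vec h g = residue_vec h (poly_op T q g)"
proof -
  let ?n = "degree h"
  interpret abelian_group "module_mat TYPE('a) ?n ?n" by (rule abelian_group_mat)
  have pow: "A ^\<^sub>m k *\<^sub>v residue_vec h g = residue_vec h ((T ^^ k) g)" for k g
    using A by (induction k arbitrary: g)
      (simp_all add: assoc_mult_mat_vec[of _ ?n ?n _ ?n] T funpow_swap1)
  have closed: "coeff q k \<cdot>\<^sub>m A ^\<^sub>m k \<in> carrier_mat ?n ?n" for k using A by simp
  \<comment> \<open>Generalised to any finite index set, so that \<open>finsum\<close> can be
    unfolded one index at a time.\<close>
  have "finsum (module_mat TYPE('a) ?n ?n) (\<lambda>k. coeff q k \<cdot>\<^sub>m A ^\<^sub>m k) S *\<^sub>v residue_vec h g =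
      residue_vec h (\<Sum>k\<in>S. Polynomial.smult (coeff q k) ((T ^^ k) g))" if "finite S" for S
    using that
  proof (induction S)
    case empty
    then show ?case by (simp add: module_mat_simps residue_vec_0 zero_mat_mult_vec)
  next
    case (insert k S)
    let ?F = "finsum (module_mat TYPE('a) ?n ?n) (\<lambda>k. coeff q k \<cdot>\<^sub>m A ^\<^sub>m k) S"
    have "?F \<in> carrier_mat ?n ?n"
      using finsum_closed[of "\<lambda>k. coeff q k \<cdot>\<^sub>m A ^\<^sub>m k" S] closed by (simp add: module_mat_simps)
    moreover have "finsum (module_mat TYPE('a) ?n ?n) (\<lambda>k. coeff q k \<cdot>\<^sub>m A ^\<^sub>m k) (insert k S) =
        coeff q k \<cdot>\<^sub>m A ^\<^sub>m k + ?F"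
      using insert.hyps closed by (simp add: finsum_insert module_mat_simps Pi_def)
    ultimately show ?case
      using insert.hyps A closed
      by (simp add: insert.IH add_mult_distrib_mat_vec[of _ ?n ?n] smult_mat_mult_vec[of _ ?n ?n] pow
          residue_vec_add residue_vec_smult)
  qed
  then show ?thesis using A by (simp add: poly_mat_def poly_op_def)
qed

section \<open>Minimal polynomials\<close>

lemma poly_mat_eq_0_iff:
  fixes A :: "'a :: field mat"
  assumes A: "A \<in> carrier_mat (degree h) (degree h)" and "degree h > 0"
    and T: "\<And>g. A *\<^sub>v residue_vec h g = residue_vec h (T g)"
  shows "poly_mat q A = 0\<^sub>m (degree h) (degree h) \<longleftrightarrow> (\<forall>g. h dvd poly_op T q g)"
proof -
  have "poly_mat q A = 0\<^sub>m (degree h) (degree h) \<longleftrightarrow>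
      (\<forall>g. poly_mat q A *\<^sub>v residue_vec h g = 0\<^sub>v (degree h))"
    using mat_eqI_residue_vec[OF assms(2) poly_mat_carrier[OF A] zero_carrier_mat, of q]
    by (auto simp: zero_mat_mult_vec)
  then show ?thesis
    by (simp add: poly_mat_mult_residue_vec[OF A T] residue_vec_eq_0_iff[OF assms(2)])
qed

text \<open>Evaluating \<open>q\<close> at multiplication by X gives multiplication by
  \<open>q\<close>. It kills F[X]/(h) iff it kills the class of 1, that is, iff \<open>h\<close>
  divides \<open>q\<close>.\<close>

lemma is_minimal_poly_mult_X:
  fixes A :: "'a :: field mat"
  assumes A: "A \<in> carrier_mat (degree h) (degree h)" and "monic h" "degree h > 0"
    and X: "\<And>g. A *\<^sub>v residue_vec h g = residue_vec h ([:0, 1:] * g)"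
  shows "is_minimal_poly A h"
proof -
  have "poly_mat q A = 0\<^sub>m (degree h) (degree h) \<longleftrightarrow> h dvd q" for q
  proof -
    have "(\<forall>g. h dvd q * g) \<longleftrightarrow> h dvd q" by (metis dvd_mult2 mult.right_neutral)
    then show ?thesis by (simp only: poly_mat_eq_0_iff[OF A assms(3) X] poly_op_mult_X)
  qed
  then show ?thesis
    using A assms(2) by (auto simp: is_minimal_poly_def intro: dvd_imp_degree_le)
qed

lemma linear_power_eq_pcompose: "[:a, 1:] ^ k = monom 1 k \<circ>\<^sub>p [:a, 1:]"
  for a :: "'a :: field"
  by (induction k) (simp_all add: monom_Suc pcompose_pCons pcompose_1[folded one_pCons])

text \<open>After the shift by \<beta> the operator is \<alpha> d/dX, whose p-th power is zero. A
  nonzero \<open>r\<close> of degree below \<open>p\<close> with lowest index \<open>k\<close> maps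
  X^k to a constant with factor k!, nonzero as k < p, and the nonconstant \<open>h\<close> divides
  no nonzero constant.\<close>

lemma is_minimal_poly_smult_pderiv:
  fixes A :: "'a :: field mat"
  assumes A: "A \<in> carrier_mat (degree h) (degree h)" and h: "degree h > 0"
    and T: "\<And>g. A *\<^sub>v residue_vec h g =
      residue_vec h (Polynomial.smult \<beta> g + Polynomial.smult \<alpha> (pderiv g))"
    and "CHAR('a) = p" "prime p" "\<alpha> \<noteq> 0"
  shows "is_minimal_poly A ([:- \<beta>, 1:] ^ p)"
proof -
  have zero_iff: "poly_mat (r \<circ>\<^sub>p [:- \<beta>, 1:]) A = 0\<^sub>m (degree h) (degree h) \<longleftrightarrow>
      (\<forall>g. h dvd poly_op (\<lambda>g. Polynomial.smult \<alpha> (pderiv g)) r g)" for r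
    by (subst poly_mat_eq_0_iff[OF A h T], subst poly_op_pcompose_linear)
      (simp_all add: smult_add_right pderiv_add pderiv_smult mult.commute)
  have "poly_op (\<lambda>g. Polynomial.smult \<alpha> (pderiv g)) (monom 1 p) g = 0" for g
    by (simp add: poly_op_def degree_monom_eq funpow_smult_pderiv)
      (auto intro!: sum.neutral simp: higher_pderiv_CHAR assms)
  then have "poly_mat ([:- \<beta>, 1:] ^ p) A = 0\<^sub>m (degree h) (degree h)"
    unfolding linear_power_eq_pcompose zero_iff by simp
  moreover have "p \<le> degree q" if "q \<noteq> 0" "poly_mat q A = 0\<^sub>m (degree h) (degree h)" for q
  proof (rule ccontr)
    assume "\<not> p \<le> degree q"
    \<comment> \<open>Substituting X + \<beta> undoes the shift, so that \<open>zero_iff\<close>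
      applies to \<open>r\<close>.\<close>
    define r where "r = q \<circ>\<^sub>p [:\<beta>, 1:]"
    have q: "q = r \<circ>\<^sub>p [:- \<beta>, 1:]"
      by (simp add: r_def pcompose_assoc[symmetric] pcompose_pCons)
    have "degree r = degree q" by (simp add: r_def degree_pcompose)
    define k where "k = (LEAST i. coeff r i \<noteq> 0)"
    have "r \<noteq> 0" using that(1) by (auto simp: q)
    then have "coeff r (degree r) \<noteq> 0" by simp
    then have k: "coeff r k \<noteq> 0" "k \<le> degree r"
      unfolding k_def by (rule LeastI, rule Least_le)
    have "coeff r i = 0" if "i < k" for i
      using not_less_Least that by (auto simp: k_def)
    then have "h dvd [:coeff r k * \<alpha> ^ k * of_nat (fact k):]"
      using that(2) unfolding q zero_iff by (metis poly_op_smult_pderiv_lowest)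
    moreover have "\<not> p dvd fact k"
      using k(2) \<open>degree r = degree q\<close> \<open>\<not> p \<le> degree q\<close> assms(5) by (simp add: prime_dvd_fact_iff)
    then have "of_nat (fact k) \<noteq> (0 :: 'a)"
      unfolding of_nat_eq_0_iff_char_dvd assms(4) .
    then have "coeff r k * \<alpha> ^ k * of_nat (fact k) \<noteq> 0" using k(1) assms(6) by simp
    ultimately show False
      using h dvd_imp_degree_le[of h "[:coeff r k * \<alpha> ^ k * of_nat (fact k):]"] by simp
  qed
  moreover have "monic ([:- \<beta>, 1:] ^ p)" by (rule monic_power) simp
  moreover have "degree ([:- \<beta>, 1:] ^ p) = p" by (rule degree_linear_power)
  ultimately show ?thesis
    using A by (auto simp: is_minimal_poly_def)
qed

section \<open>Heisenberg modules of polynomials\<close>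

text \<open>Subtracting the scalar parts of \<open>heis_y\<close> and \<open>heis_x\<close>, and
  dividing by \<alpha>, shows that \<open>I\<close> is closed under multiplication by X and under
  d/dX. It is thus an ideal, generated by a nonzero element of least degree unless it is zero.
  Conversely, the product rule makes such an ideal stable.\<close>

lemma lie_submodule_heis_poly_mod_iff:
  fixes \<alpha> :: "'a :: field"
  assumes "\<alpha> \<noteq> 0"
  shows "lie_submodule class_ring heisenberg I (heis_poly_mod \<alpha> \<beta> \<gamma>) \<longleftrightarrow>
    (\<exists>d. pderiv d = 0 \<and> I = {g. d dvd g})"
proof
  assume I: "lie_submodule class_ring heisenberg I (heis_poly_mod \<alpha> \<beta> \<gamma>)"
  note Id = lie_submoduleD[OF I]
  have add: "g + g' \<in> I" if "g \<in> I" "g' \<in> I" for g g'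
    using Id(4)[OF that] by (simp add: heis_poly_mod_def)
  have smult: "Polynomial.smult c g \<in> I" if "g \<in> I" for c g
    using Id(5)[of c, OF _ that] by (simp add: heis_poly_mod_def)
  have zero: "0 \<in> I" using Id(3) by (simp add: heis_poly_mod_def)
  have X: "pCons 0 g \<in> I" if "g \<in> I" for g
  proof -
    have "Polynomial.smult \<gamma> g + pCons 0 g \<in> I"
      using Id(6)[of heis_y, OF _ that] by (simp add: heis_poly_mod_def heis_y_def)
    from add[OF this smult[OF that, of "- \<gamma>"]] show ?thesis by simp
  qed
  have D: "pderiv g \<in> I" if "g \<in> I" for g
  proof -
    have "Polynomial.smult \<beta> g + Polynomial.smult \<alpha> (pderiv g) \<in> I"
      using Id(6)[of heis_x, OF _ that] by (simp add: heis_poly_mod_def heis_x_def)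
    from smult[OF add[OF this smult[OF that, of "- \<beta>"]], of "inverse \<alpha>"]
    show ?thesis using assms by simp
  qed
  have mult: "q * g \<in> I" if "g \<in> I" for q g
    by (induction q) (simp_all add: zero add smult X that)
  show "\<exists>d. pderiv d = 0 \<and> I = {g. d dvd g}"
  proof (cases "I = {0}")
    case True
    then show ?thesis by (intro exI[of _ 0]) auto
  next
    case False
    then obtain d0 where "d0 \<in> I \<and> d0 \<noteq> 0" using zero by blast
    then obtain d where d: "d \<in> I \<and> d \<noteq> 0"
      and least: "\<And>g. g \<in> I \<and> g \<noteq> 0 \<Longrightarrow> degree d \<le> degree g"
      using ex_has_least_nat[of "\<lambda>g. g \<in> I \<and> g \<noteq> 0" d0 degree] by blast
    have dvd: "d dvd g" if "g \<in> I" for g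
    proof -
      have "g mod d = g + - (g div d) * d"
        using div_mult_mod_eq[of g d] by (simp add: algebra_simps)
      then have "g mod d \<in> I" using add[OF that mult[of d "- (g div d)"]] d by simp
      then have "g mod d = 0" using least[of "g mod d"] degree_mod_less'[of d g] d by fastforce
      then show ?thesis by auto
    qed
    have "pderiv d = 0"
    proof (rule ccontr)
      assume nz: "pderiv d \<noteq> 0"
      \<comment> \<open>Minimality of \<open>d\<close> is contradicted unless \<open>d\<close> is
        constant, and then its derivative is zero anyway.\<close>
      have "degree d \<le> degree (pderiv d)" using least D d nz by blast
      then have "degree d = 0" using degree_pderiv_le[of d] by simp
      then show False using nz by (auto elim: degree_eq_zeroE)
    qed
    moreover have "I = {g. d dvd g}"
      using dvd mult d by (auto elim!: dvdE simp: mult.commute)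
    ultimately show ?thesis by blast
  qed
next
  assume "\<exists>d. pderiv d = 0 \<and> I = {g. d dvd g}"
  then obtain d where d: "pderiv d = 0" and I: "I = {g. d dvd g}" by blast
  interpret lie_module "class_ring :: 'a ring" heisenberg "heis_poly_mod \<alpha> \<beta> \<gamma>"
    by (rule lie_module_heis_poly_mod)
  have "d dvd pderiv g" if "d dvd g" for g
    using that d by (auto simp: pderiv_mult elim!: dvdE)
  then have "\<forall>x \<in> carrier heisenberg. \<forall>g \<in> I. act (heis_poly_mod \<alpha> \<beta> \<gamma>) x g \<in> I"
    unfolding I
    by (simp add: heis_poly_mod_def del: mult_pCons_left) (intro allI impI dvd_add dvd_smult dvd_mult; simp)
  moreover have "submodule (class_ring :: 'a ring) I (heis_poly_mod \<alpha> \<beta> \<gamma>)"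
    unfolding I by (rule submodule.intro[OF rep.module_axioms])
      (auto simp: heis_poly_mod_def intro: dvd_add dvd_smult)
  ultimately show "lie_submodule class_ring heisenberg I (heis_poly_mod \<alpha> \<beta> \<gamma>)"
    by (simp add: lie_submodule_def)
qed

section \<open>The representation R as a quotient of the polynomial module\<close>

locale heisenberg_companion =
  fixes p m :: nat and \<alpha> \<beta> :: "'a :: field" and f :: "'a poly"
  assumes p: "prime p" and CHAR: "CHAR('a) = p" and \<alpha>: "\<alpha> \<noteq> 0"
    and m: "m \<ge> 1" and f: "monic f" "degree f = m"
begin

definition fp :: "'a poly" where "fp = f \<circ>\<^sub>p monom 1 p"

text \<open>The last parameter is 0 because the companion matrix acts as multiplication by X itself,
  without a scalar part.\<close>

abbreviation P :: "('a, 'a \<times> 'a \<times> 'a, 'a poly) lie_mod" where "P \<equiv> heis_poly_mod \<alpha> \<beta> 0"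

definition R :: "'a \<times> 'a \<times> 'a \<Rightarrow> 'a mat"
  where "R = heis_lin (gl (p * m)) (diag_block_mat (replicate m (M_mat p \<alpha> \<beta>)))
    (companion_mat fp) (\<alpha> \<cdot>\<^sub>m 1\<^sub>m (p * m))"

abbreviation N :: "('a, 'a \<times> 'a \<times> 'a, 'a vec) lie_mod" where "N \<equiv> rep_mod (p * m) R"

lemma p_gt: "p > 0" "p \<ge> 2"
  using p prime_gt_0_nat prime_ge_2_nat by auto

lemma degree_fp: "degree fp = p * m"
  using f by (simp add: fp_def degree_pcompose degree_monom_eq mult.commute)

text \<open>Polynomials of degree at most 1 are therefore their own residues, which
  \<open>R_inj\<close> exploits.\<close>

lemma degree_fp_ge_2: "degree fp \<ge> 2"
  using mult_le_mono[OF p_gt(2) m] by (simp add: degree_fp)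

lemma degree_fp_pos: "degree fp > 0"
  using degree_fp_ge_2 by simp

lemma monic_fp: "monic fp"
  unfolding fp_def by (rule monic_pcompose_monom[OF p_gt(1) f(1)])

lemma pderiv_fp: "pderiv fp = 0"
  unfolding fp_def by (rule pderiv_pcompose_monom_CHAR[OF CHAR])

lemma R_eq: "R (a, b, c) = a \<cdot>\<^sub>m M_mat (p * m) \<alpha> \<beta> + b \<cdot>\<^sub>m companion_mat fp + c \<cdot>\<^sub>m (\<alpha> \<cdot>\<^sub>m 1\<^sub>m (p * m))"
  by (simp add: R_def heis_lin_def diag_block_M_mat[OF CHAR p_gt(1)])

lemma carriers:
  "M_mat (p * m) \<alpha> \<beta> \<in> carrier_mat (p * m) (p * m)"
  "companion_mat fp \<in> carrier_mat (p * m) (p * m)"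
  by (simp_all add: M_mat_def companion_mat_def degree_fp)

lemma R_closed: "R u \<in> carrier_mat (p * m) (p * m)"
  using carriers by (cases u) (simp add: R_eq)

text \<open>Equivariance of the residue map: it transfers questions about the matrices to operators
  on F[X].\<close>

lemma R_mult_residue_vec: "R u *\<^sub>v residue_vec fp g = residue_vec fp (act P u g)"
proof -
  obtain a b c where u: "u = (a, b, c)" by (cases u)
  have [simp]: "residue_vec fp g \<in> carrier_vec (p * m)"
    using residue_vec_carrier[of fp g] by (simp add: degree_fp)
  have "R u *\<^sub>v residue_vec fp g =
      a \<cdot>\<^sub>v residue_vec fp (Polynomial.smult \<beta> g + Polynomial.smult \<alpha> (pderiv g)) +
      b \<cdot>\<^sub>v residue_vec fp ([:0, 1:] * g) + c \<cdot>\<^sub>v (\<alpha> \<cdot>\<^sub>v residue_vec fp g)"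
    using carriers M_mat_mult_residue_vec[OF pderiv_fp degree_fp_pos, of \<alpha> \<beta> g]
      companion_mat_mult_residue_vec[OF monic_fp degree_fp_pos, of g]
    by (simp add: u R_eq add_mult_distrib_mat_vec[of _ "p * m" "p * m"]
        smult_mat_mult_vec[of _ "p * m" "p * m"] degree_fp del: mult_pCons_left)
  then show ?thesis
    by (simp add: u heis_poly_mod_def del: mult_pCons_left flip: residue_vec_smult residue_vec_add)
qed

lemma R_basis:
  "R heis_x *\<^sub>v residue_vec fp g = residue_vec fp (Polynomial.smult \<beta> g + Polynomial.smult \<alpha> (pderiv g))"
  "R heis_y *\<^sub>v residue_vec fp g = residue_vec fp ([:0, 1:] * g)"
  by (simp_all add: R_mult_residue_vec heis_x_def heis_y_def heis_poly_mod_def)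

lemma R_eqI: "R u = B"
  if "B \<in> carrier_mat (p * m) (p * m)" "\<And>g. B *\<^sub>v residue_vec fp g = residue_vec fp (act P u g)"
  using that by (intro mat_eqI_residue_vec[OF degree_fp_pos])
    (simp_all add: degree_fp R_closed R_mult_residue_vec)

lemma R_linear: "R \<in> module_hom class_ring heisenberg (gl (p * m))"
proof -
  interpret G: lie_algebra "class_ring :: 'a ring" "gl (p * m)" by (rule lie_algebra_gl)
  show ?thesis
    using heis_lin_unique[OF G.vectorspace_axioms, of "M_mat (p * m) \<alpha> \<beta>" "companion_mat fp"
        "\<alpha> \<cdot>\<^sub>m 1\<^sub>m (p * m)" R] carriers
    by (simp add: R_def diag_block_M_mat[OF CHAR p_gt(1)])
qed

text \<open>The bracket relation is checked on F[X], where it amounts to the commutator of d/dX and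
  X being 1, and descends to residues.\<close>

lemma lie_algebra_hom_R: "lie_algebra_hom class_ring heisenberg (gl (p * m)) R"
proof -
  interpret H: lie_algebra "class_ring :: 'a ring" heisenberg by (rule lie_algebra_heisenberg)
  interpret G: lie_algebra "class_ring :: 'a ring" "gl (p * m)" by (rule lie_algebra_gl)
  show ?thesis
  proof (unfold_locales, rule R_linear)
    fix u v :: "'a \<times> 'a \<times> 'a"
    have closed: "R u * R v \<in> carrier_mat (p * m) (p * m)" "R v * R u \<in> carrier_mat (p * m) (p * m)"
      using R_closed[of u] R_closed[of v] by auto
    have "R (bracket heisenberg u v) = R u * R v - R v * R u"
    proof (rule R_eqI)
      fix g
      have [simp]: "residue_vec fp g \<in> carrier_vec (p * m)" for g
        using residue_vec_carrier[of fp g] by (simp add: degree_fp)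
      have "(R u * R v - R v * R u) *\<^sub>v residue_vec fp g =
          residue_vec fp (act P u (act P v g)) - residue_vec fp (act P v (act P u g))"
        using closed R_closed[of u] R_closed[of v]
        by (simp add: minus_mult_distrib_mat_vec[of _ "p * m" "p * m"]
            assoc_mult_mat_vec[of _ "p * m" "p * m" _ "p * m"] R_mult_residue_vec)
      also have "\<dots> = residue_vec fp (act P u (act P v g) - act P v (act P u g))"
        by (intro eq_vecI) (simp_all add: residue_vec_def poly_mod_diff_left)
      also have "act P u (act P v g) - act P v (act P u g) = act P (bracket heisenberg u v) g"
        by (cases u, cases v) (simp add: heis_poly_mod_def pderiv_add pderiv_smult pderiv_mult
          pderiv_pCons smult_add_right smult_diff_right algebra_simps smult_add_left smult_diff_left)
      finally show "(R u * R v - R v * R u) *\<^sub>v residue_vec fp g =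
          residue_vec fp (act P (bracket heisenberg u v) g)" .
    qed (intro minus_carrier_mat closed)
    then show "R (bracket heisenberg u v) = bracket (gl (p * m)) (R u) (R v)" by simp
  qed
qed

text \<open>The action on 1 determines \<open>b\<close> and
  \<open>a * \<beta> + c * \<alpha>\<close>; the action on X then determines
  \<open>a * \<alpha>\<close>. As \<alpha> is nonzero, all three coordinates follow.\<close>

lemma R_inj: "inj_on R (carrier heisenberg)"
proof (rule inj_onI)
  fix u v :: "'a \<times> 'a \<times> 'a"
  assume eq: "R u = R v"
  obtain a b c a' b' c' where uv: "u = (a, b, c)" "v = (a', b', c')" by (cases u, cases v)
  have act_eq: "act P u g mod fp = act P v g mod fp" for g
  proof -
    have "residue_vec fp (act P u g - act P v g) = residue_vec fp (act P u g) - residue_vec fp (act P v g)"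
      by (intro eq_vecI) (simp_all add: residue_vec_def poly_mod_diff_left)
    also have "\<dots> = R u *\<^sub>v residue_vec fp g - R v *\<^sub>v residue_vec fp g"
      by (simp only: R_mult_residue_vec)
    also have "\<dots> = 0\<^sub>v (degree fp)"
      unfolding eq using R_closed[of v] by (intro eq_vecI) (simp_all add: degree_fp)
    finally show ?thesis
      by (simp add: residue_vec_eq_0_iff[OF degree_fp_pos] mod_eq_dvd_iff)
  qed
  have "[:a * \<beta> + c * \<alpha>, b:] = [:a' * \<beta> + c' * \<alpha>, b':]"
    using act_eq[of 1] degree_fp_ge_2
    by (simp add: uv heis_poly_mod_def one_pCons mod_poly_less)
  then have b: "b = b'" and ac: "a * \<beta> + c * \<alpha> = a' * \<beta> + c' * \<alpha>" by simp_all
  have X: "act P (a, b, c) [:0, 1:] = [:a * \<alpha>, a * \<beta> + c * \<alpha>:] + Polynomial.smult b [:0, 0, 1:]" for a b c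
    by (simp add: heis_poly_mod_def pderiv_pCons)
  \<comment> \<open>If \<open>fp\<close> has degree 2, then X^2 is not its own residue; but since
    \<open>b = b'\<close> the quadratic terms agree and cancel.\<close>
  have "[:a * \<alpha>, a * \<beta> + c * \<alpha>:] mod fp = [:a' * \<alpha>, a' * \<beta> + c' * \<alpha>:] mod fp"
    using act_eq[of "[:0, 1:]"] unfolding uv X b by (simp only: poly_mod_add_left add_right_cancel)
  then have "[:a * \<alpha>, a * \<beta> + c * \<alpha>:] = [:a' * \<alpha>, a' * \<beta> + c' * \<alpha>:]"
    using degree_fp_ge_2 by (simp add: mod_poly_less)
  then show "u = v" using \<alpha> b ac by (simp add: uv)
qed

lemma is_minimal_poly_R_heis_x: "is_minimal_poly (R heis_x) ([:- \<beta>, 1:] ^ p)"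
  by (rule is_minimal_poly_smult_pderiv[OF _ degree_fp_pos R_basis(1) CHAR p \<alpha>])
    (simp add: degree_fp R_closed)

lemma is_minimal_poly_R_heis_y: "is_minimal_poly (R heis_y) fp"
  by (rule is_minimal_poly_mult_X[OF _ monic_fp degree_fp_pos R_basis(2)])
    (simp add: degree_fp R_closed)

lemma lie_module_hom_residue_vec: "lie_module_hom class_ring heisenberg P N (residue_vec fp)"
proof -
  interpret P: lie_module "class_ring :: 'a ring" heisenberg P by (rule lie_module_heis_poly_mod)
  interpret N: lie_module "class_ring :: 'a ring" heisenberg N
    by (rule lie_module_rep_mod[OF lie_algebra_hom_R])
  have "residue_vec fp g \<in> carrier_vec (p * m)" for g
    using residue_vec_carrier[of fp g] by (simp add: degree_fp)
  moreover have "residue_vec fp (act P u g) = R u *\<^sub>v residue_vec fp g" for u g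
    by (simp add: R_mult_residue_vec)
  ultimately show ?thesis
    by unfold_locales
      (simp_all add: module_hom_def, simp_all add: heis_poly_mod_def residue_vec_add residue_vec_smult)
qed

sublocale res: lie_module_hom "class_ring :: 'a ring" heisenberg P N "residue_vec fp"
  by (rule lie_module_hom_residue_vec)

lemma carrier_P: "carrier (heis_poly_mod a b c) = UNIV"
  by (simp add: heis_poly_mod_def)

lemma residue_vec_onto: "residue_vec fp ` carrier P = carrier N"
proof -
  have "v \<in> range (residue_vec fp)" if "v \<in> carrier_vec (p * m)" for v
    using residue_vec_surj[OF degree_fp_pos, of v] that unfolding degree_fp by blast
  then show ?thesis
    using residue_vec_carrier[of fp] by (auto simp: carrier_P degree_fp)
qed

lemma ker_residue_vec: "res.lin.ker = {g. fp dvd g}"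
  using residue_vec_eq_0_iff[OF degree_fp_pos] by (auto simp: res.lin.ker_def carrier_P degree_fp)

text \<open>A submodule above the kernel is generated by some u(X^p) dividing \<open>fp\<close>, so
  \<open>u\<close> divides \<open>f\<close>. Irreducibility makes \<open>u\<close> an associate of
  \<open>f\<close> or a unit.\<close>

lemma lie_irreducible_N:
  assumes "irreducible f"
  shows "lie_irreducible class_ring heisenberg N"
  unfolding res.lie_irreducible_iff[OF residue_vec_onto] ker_residue_vec
proof (intro conjI allI impI)
  have "\<not> fp dvd 1" using degree_fp_pos by (auto simp: is_unit_iff_degree)
  then show "{g. fp dvd g} \<noteq> carrier P" by (metis UNIV_I carrier_P mem_Collect_eq)
next
  fix W assume W: "lie_submodule class_ring heisenberg W P" "{g. fp dvd g} \<subseteq> W"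
  obtain d where d: "pderiv d = 0" "W = {g. d dvd g}"
    using W(1) unfolding lie_submodule_heis_poly_mod_iff[OF \<alpha>] by blast
  obtain u where u: "d = u \<circ>\<^sub>p monom 1 p"
    using pderiv_eq_0_CHARE[OF d(1) CHAR p_gt(1)] .
  have "fp \<in> W" using W(2) by auto
  then have dvd: "d dvd fp" unfolding d(2) by simp
  then have "u dvd f" by (simp add: u fp_def pcompose_monom_dvd_iff p_gt)
  then consider "f dvd u" | "u dvd 1" using irreducibleD'[OF assms] by blast
  then show "W = {g. fp dvd g} \<or> W = carrier P"
  proof cases
    case 1
    then have "fp dvd d" by (simp add: u fp_def pcompose_monom_dvd_iff p_gt)
    then have "d dvd g \<longleftrightarrow> fp dvd g" for g using dvd dvd_trans by metis
    then have "{g. d dvd g} = {g. fp dvd g}" by (rule Collect_cong)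
    then show ?thesis unfolding d(2) by (rule disjI1)
  next
    case 2
    then have "d dvd 1"
      using pcompose_monom_dvd_iff[OF p_gt(1), of u 1] by (simp add: u pcompose_1)
    then have "d dvd g" for g using dvd_trans one_dvd by metis
    then have "{g. d dvd g} = carrier P" unfolding carrier_P by fast
    then show ?thesis unfolding d(2) by (rule disjI2)
  qed
qed

end

section \<open>The uniserial case\<close>

locale heisenberg_companion_power = heisenberg_companion +
  fixes \<gamma> :: 'a
  assumes f_power: "f = [:- (\<gamma> ^ p), 1:] ^ m"
begin

definition L :: "'a poly" where "L = [:- \<gamma>, 1:]"

text \<open>The exponent counts down so that the chain increases, from zero at index 0 to the whole
  space at index \<open>m\<close>.\<close>

definition S :: "nat \<Rightarrow> 'a vec set"
  where "S k = residue_vec fp ` {g. L ^ (p * (m - k)) dvd g}"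

lemma fp_power: "fp = L ^ (p * m)"
proof -
  have "[:- (\<gamma> ^ p), 1:] \<circ>\<^sub>p monom 1 p = monom 1 p - [:\<gamma> ^ p:]"
    by (simp add: pcompose_pCons)
  also have "\<dots> = [:0, 1:] ^ p - [:\<gamma>:] ^ p"
    by (simp add: monom_altdef poly_const_pow)
  also have "\<dots> = L ^ p"
  proof -
    \<comment> \<open>Applying the dream to the sum X = L + \<gamma> avoids the sign of
      (-\<gamma>)^p.\<close>
    have "[:0, 1:] ^ p = (L + [:\<gamma>:]) ^ p" by (simp add: L_def)
    also have "\<dots> = L ^ p + [:\<gamma>:] ^ p"
      using p CHAR by (intro freshmans_dream) simp_all
    finally show ?thesis by simp
  qed
  finally have "[:- (\<gamma> ^ p), 1:] \<circ>\<^sub>p monom 1 p = L ^ p" .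
  moreover have "fp = [:- (\<gamma> ^ p), 1:] ^ m \<circ>\<^sub>p monom 1 p"
    unfolding fp_def by (simp only: f_power)
  ultimately show ?thesis by (simp only: pcompose_hom.hom_power power_mult)
qed

lemma L_nz: "L \<noteq> 0" and degree_L_power: "degree (L ^ k) = k"
  by (simp_all add: L_def degree_linear_power)

lemma L_power_dvd_iff: "L ^ k dvd L ^ l \<longleftrightarrow> k \<le> l"
  using dvd_imp_degree_le[of "L ^ k" "L ^ l"] L_nz by (auto simp: degree_L_power intro: le_imp_power_dvd)

lemma lie_submodule_L_power: "lie_submodule class_ring heisenberg {g. L ^ (p * k) dvd g} P"
  unfolding lie_submodule_heis_poly_mod_iff[OF \<alpha>] using pderiv_power_CHAR_mult[OF CHAR] by blast

text \<open>Membership does not depend on the representative, because the ideal defining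
  \<open>S k\<close> contains \<open>fp\<close> and hence the kernel.\<close>

lemma residue_vec_in_S_iff: "residue_vec fp g \<in> S k \<longleftrightarrow> L ^ (p * (m - k)) dvd g"
proof -
  have "L ^ (p * (m - k)) dvd fp" by (simp only: fp_power L_power_dvd_iff) simp
  then have "res.lin.ker \<subseteq> {g. L ^ (p * (m - k)) dvd g}"
    unfolding ker_residue_vec by (auto intro: dvd_trans)
  from res.vimage_image_eq[OF lie_submodule_L_power this] show ?thesis
    by (auto simp: S_def carrier_P)
qed

lemma lie_submodule_S: "lie_submodule class_ring heisenberg (S k) N"
  unfolding S_def by (rule res.lie_submodule_image[OF lie_submodule_L_power])

text \<open>The preimage of \<open>W\<close> contains \<open>fp\<close>, a power of
  \<open>L\<close>, so its generator is a scalar multiple of some L^k. Its derivative, a multiple of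
  k L^(k-1), must vanish, and this forces \<open>p\<close> to divide \<open>k\<close>.\<close>

lemma lie_submodule_N_iff: "lie_submodule class_ring heisenberg W N \<longleftrightarrow> (\<exists>i\<le>m. W = S i)"
proof
  assume W: "lie_submodule class_ring heisenberg W N"
  let ?I = "{g \<in> carrier P. residue_vec fp g \<in> W}"
  obtain d where d: "pderiv d = 0" "?I = {g. d dvd g}"
    using res.lie_submodule_vimage[OF W] unfolding lie_submodule_heis_poly_mod_iff[OF \<alpha>] by blast
  have "residue_vec fp fp = 0\<^sub>v (p * m)"
    using residue_vec_eq_0_iff[OF degree_fp_pos, of fp] by (simp add: degree_fp)
  then have "fp \<in> ?I"
    using lie_submoduleD(3)[OF W] by (simp add: carrier_P)
  then have "d dvd fp" unfolding d(2) by simp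
  then have "d dvd [:- \<gamma>, 1:] ^ (p * m)" by (simp only: fp_power L_def)
  then obtain k a where k: "k \<le> p * m" "a \<noteq> 0" "d = Polynomial.smult a (L ^ k)"
    unfolding L_def by (rule dvd_linear_power)
  have "p dvd k"
  proof (cases k)
    case (Suc l)
    have "Polynomial.smult (a * of_nat (Suc l)) (L ^ l) = pderiv d"
      by (simp only: k(3) Suc pderiv_smult pderiv_power_Suc) (simp add: L_def pderiv_pCons)
    then have "of_nat k = (0 :: 'a)" using d(1) k(2) L_nz Suc by auto
    then show ?thesis using CHAR by (simp add: of_nat_eq_0_iff_char_dvd)
  qed simp
  then obtain j where j: "k = p * j" by (elim dvdE)
  with k(1) p_gt have "j \<le> m" by simp
  have "W = residue_vec fp ` ?I"
    using lie_submoduleD(2)[OF W] residue_vec_onto by auto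
  also have "?I = {g. L ^ (p * j) dvd g}"
    using d(2) k(2) by (simp add: k(3) j smult_dvd_iff)
  finally have "W = S (m - j)" using \<open>j \<le> m\<close> by (simp add: S_def)
  then show "\<exists>i\<le>m. W = S i" by (intro exI[of _ "m - j"]) simp
qed (auto simp: lie_submodule_S)

sublocale chain: lie_module_chain "class_ring :: 'a ring" heisenberg N S m
proof
  show "lie_submodule class_ring heisenberg W N \<longleftrightarrow> (\<exists>i\<le>m. W = S i)" for W
    by (rule lie_submodule_N_iff)
  show "S i \<subseteq> S j \<longleftrightarrow> i \<le> j" if "i \<le> m" "j \<le> m" for i j
  proof
    assume "S i \<subseteq> S j"
    \<comment> \<open>The inclusion is tested on the generator of \<open>S i\<close>.\<close>
    then have "residue_vec fp (L ^ (p * (m - i))) \<in> S j"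
      using residue_vec_in_S_iff[of "L ^ (p * (m - i))" i] by auto
    then show "i \<le> j"
      using that p_gt by (simp add: residue_vec_in_S_iff L_power_dvd_iff)
  next
    assume "i \<le> j"
    then have "L ^ (p * (m - j)) dvd L ^ (p * (m - i))"
      unfolding L_power_dvd_iff by (intro mult_le_mono2 diff_le_mono2)
    then show "S i \<subseteq> S j" unfolding S_def by (auto intro!: imageI intro: dvd_trans)
  qed
  show "S 0 = {\<zero>\<^bsub>N\<^esub>}"
  proof -
    have "S 0 = residue_vec fp ` {g. fp dvd g}" by (simp add: S_def fp_power)
    also have "\<dots> = {0\<^sub>v (p * m)}"
    proof -
      have "0\<^sub>v (p * m) = residue_vec fp 0" by (simp add: residue_vec_0 degree_fp)
      then have "0\<^sub>v (p * m) \<in> residue_vec fp ` {g. fp dvd g}" by (rule image_eqI) simp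
      then show ?thesis using residue_vec_eq_0_iff[OF degree_fp_pos] by (auto simp: degree_fp)
    qed
    finally show ?thesis by simp
  qed
  show "S m = carrier N"
    unfolding residue_vec_onto[symmetric] by (simp add: S_def carrier_P)
qed

text \<open>The map \<tau> followed by the residue map sends F[X] onto \<open>S (Suc i)\<close>. A
  polynomial \<open>g\<close> lands in \<open>S i\<close> iff L^(p+e) divides g(L) L^e, that is, iff
  X^p divides \<open>g\<close>. The first isomorphism theorem then yields the claim.\<close>

lemma factor_isomorphic_V_mod:
  assumes i: "i < m"
  shows "lie_mod_isomorphic class_ring heisenberg
    (lie_quot (N\<lparr>carrier := S (Suc i)\<rparr>) (S i)) (V_mod p \<alpha> \<beta> \<gamma>)"
proof -
  let ?P\<gamma> = "heis_poly_mod \<alpha> \<beta> \<gamma>" and ?B = "N\<lparr>carrier := S (Suc i)\<rparr>"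
  let ?Q = "lie_quot ?B (S i)"
  \<comment> \<open>\<open>L ^ e\<close> generates the ideal behind \<open>S (Suc i)\<close>. As
    \<open>e\<close> is a multiple of \<open>p\<close>, multiplication by \<open>L ^ e\<close>
    commutes with d/dX.\<close>
  define e where "e = p * (m - Suc i)"
  define \<tau> where "\<tau> g = g \<circ>\<^sub>p L * L ^ e" for g
  have e: "p * (m - i) = p + e"
    using i by (simp add: e_def flip: mult_Suc_right) (metis Suc_diff_Suc)
  have pderiv_L: "pderiv L = 1" "pderiv (L ^ e) = 0"
    unfolding e_def using pderiv_power_CHAR_mult[OF CHAR] by (simp_all add: L_def pderiv_pCons)
  have \<tau>_add: "\<tau> (g + g') = \<tau> g + \<tau> g'" for g g'
    by (simp add: \<tau>_def pcompose_add distrib_right)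
  have \<tau>_smult: "\<tau> (Polynomial.smult c g) = Polynomial.smult c (\<tau> g)" for c g
    by (simp add: \<tau>_def pcompose_smult)
  have \<tau>_pderiv: "\<tau> (pderiv g) = pderiv (\<tau> g)" for g
    by (simp add: \<tau>_def pderiv_mult pderiv_pcompose pderiv_L)
  \<comment> \<open>Substitution turns X into X - \<gamma>, so \<gamma> + X on the source becomes
    plain multiplication by X on \<open>P\<close>.\<close>
  have \<tau>_X: "\<tau> ([:0, 1:] * g) = [:0, 1:] * \<tau> g - Polynomial.smult \<gamma> (\<tau> g)" for g
  proof -
    have "\<tau> ([:0, 1:] * g) = L * \<tau> g"
      by (simp only: \<tau>_def pcompose_mult) (simp add: pcompose_pCons mult.assoc)
    also have "L = [:0, 1:] - [:\<gamma>:]" by (simp add: L_def)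
    finally show ?thesis by (simp add: left_diff_distrib)
  qed
  have \<tau>_act: "\<tau> (act ?P\<gamma> u g) = act P u (\<tau> g)" for u g
    by (cases u) (simp add: heis_poly_mod_def \<tau>_add \<tau>_smult \<tau>_pderiv \<tau>_X del: mult_pCons_left)

  interpret P\<gamma>: lie_module "class_ring :: 'a ring" heisenberg ?P\<gamma> by (rule lie_module_heis_poly_mod)
  have hom_\<tau>: "lie_module_hom (class_ring :: 'a ring) heisenberg ?P\<gamma> P \<tau>"
    by unfold_locales (simp add: module_hom_def heis_poly_mod_def \<tau>_add \<tau>_smult, simp add: \<tau>_act)
  have \<tau>_in: "residue_vec fp (\<tau> g) \<in> S (Suc i)" for g
    by (simp add: residue_vec_in_S_iff \<tau>_def flip: e_def)
  have hom_B: "lie_module_hom (class_ring :: 'a ring) heisenberg ?P\<gamma> ?B (residue_vec fp \<circ> \<tau>)"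
    using \<tau>_in by (intro lie_module_hom_restrict[OF lie_module_hom_comp[OF hom_\<tau> res.lie_module_hom_axioms]
      lie_submodule_S]) auto
  have B: "lie_module (class_ring :: 'a ring) heisenberg ?B"
    by (rule res.cod.lie_module_restrict[OF lie_submodule_S])
  have sub: "lie_submodule class_ring heisenberg (S i) ?B"
    using res.cod.lie_submodule_restrict_iff[OF lie_submodule_S] lie_submodule_S chain.subset_iff i by simp
  let ?\<pi> = "\<lambda>u. S i +>\<^bsub>?B\<^esub> u"
  interpret \<pi>: lie_module_hom "class_ring :: 'a ring" heisenberg ?B ?Q ?\<pi>
    by (rule lie_module_hom_quot[OF B sub])
  interpret \<psi>: lie_module_hom "class_ring :: 'a ring" heisenberg ?P\<gamma> ?Q "?\<pi> \<circ> (residue_vec fp \<circ> \<tau>)"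
    by (rule lie_module_hom_comp[OF hom_B \<pi>.lie_module_hom_axioms])

  \<comment> \<open>The inverse substitution supplies preimages for surjectivity and later cancels
    the substitution in the divisibility test.\<close>
  have inv_L: "(g \<circ>\<^sub>p [:\<gamma>, 1:]) \<circ>\<^sub>p L = g" "(g \<circ>\<^sub>p L) \<circ>\<^sub>p [:\<gamma>, 1:] = g" for g
    by (simp_all add: L_def pcompose_pCons flip: pcompose_assoc)
  have "S (Suc i) \<subseteq> (residue_vec fp \<circ> \<tau>) ` UNIV"
  proof
    fix v assume "v \<in> S (Suc i)"
    then obtain q where "v = residue_vec fp (q * L ^ e)"
      by (auto simp: S_def mult.commute elim!: dvdE simp flip: e_def)
    then have "v = (residue_vec fp \<circ> \<tau>) (q \<circ>\<^sub>p [:\<gamma>, 1:])" by (simp add: \<tau>_def inv_L)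
    then show "v \<in> (residue_vec fp \<circ> \<tau>) ` UNIV" by blast
  qed
  then have "(residue_vec fp \<circ> \<tau>) ` carrier ?P\<gamma> = carrier ?B"
    using \<tau>_in by (auto simp: carrier_P)
  then have surj: "(?\<pi> \<circ> (residue_vec fp \<circ> \<tau>)) ` carrier ?P\<gamma> = carrier ?Q"
    by (simp only: image_comp[symmetric] carrier_lie_quot)

  have ker_iff: "residue_vec fp (\<tau> g) \<in> S i \<longleftrightarrow> monom 1 p dvd g" for g
  proof -
    have "residue_vec fp (\<tau> g) \<in> S i \<longleftrightarrow> L ^ p dvd g \<circ>\<^sub>p L"
      using L_nz by (simp add: residue_vec_in_S_iff e \<tau>_def power_add)
    also have "L ^ p = monom 1 p \<circ>\<^sub>p L"
      by (simp add: L_def linear_power_eq_pcompose)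
    also have "monom 1 p \<circ>\<^sub>p L dvd g \<circ>\<^sub>p L \<longleftrightarrow> monom 1 p dvd g"
    proof
      assume "monom 1 p \<circ>\<^sub>p L dvd g \<circ>\<^sub>p L"
      then obtain q where "g \<circ>\<^sub>p L = monom 1 p \<circ>\<^sub>p L * q" by (elim dvdE)
      then have "(g \<circ>\<^sub>p L) \<circ>\<^sub>p [:\<gamma>, 1:] = (monom 1 p \<circ>\<^sub>p L * q) \<circ>\<^sub>p [:\<gamma>, 1:]" by simp
      then show "monom 1 p dvd g" by (simp only: pcompose_mult inv_L dvd_triv_left)
    qed (auto simp: pcompose_mult elim!: dvdE)
    finally show ?thesis .
  qed
  have "\<psi>.lin.ker = {g \<in> carrier ?P\<gamma>. (residue_vec fp \<circ> \<tau>) g \<in> \<pi>.lin.ker}"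
    using \<tau>_in by (auto simp: \<psi>.lin.ker_def \<pi>.lin.ker_def)
  also have "\<dots> = {g. monom 1 p dvd g}"
    unfolding ker_lie_quot[OF B sub] by (simp add: ker_iff carrier_P)
  finally show ?thesis
    using \<psi>.lie_mod_isomorphic_quot_ker[OF surj] by (simp add: V_mod_def)
qed

text \<open>By \<open>composition_series_iff\<close> the series is unique, so its factors are the
  quotients of consecutive \<open>S i\<close>.\<close>

lemma composition_series_factors:
  assumes "composition_series class_ring heisenberg N Ws"
  shows "length (chain_factors N Ws) = m"
    and "\<And>Q. Q \<in> set (chain_factors N Ws) \<Longrightarrow>
      lie_mod_isomorphic class_ring heisenberg Q (V_mod p \<alpha> \<beta> \<gamma>)"
proof -
  have Ws: "Ws = map S [0..<Suc m]" using assms by (simp only: chain.composition_series_iff)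
  have nth: "Ws ! i = S i" if "i \<le> m" for i
    using that unfolding Ws by (simp add: nth_append del: upt_Suc)
  have "length Ws = Suc m" by (simp add: Ws)
  then show "length (chain_factors N Ws) = m"
    and "\<And>Q. Q \<in> set (chain_factors N Ws) \<Longrightarrow>
      lie_mod_isomorphic class_ring heisenberg Q (V_mod p \<alpha> \<beta> \<gamma>)"
    by (auto simp: chain_factors_def nth factor_isomorphic_V_mod)
qed

end

theorem theorem5p1:
  fixes p m :: nat and \<alpha> \<beta> :: "'a :: field" and f :: "'a poly"
    and R :: "'a \<times> 'a \<times> 'a \<Rightarrow> 'a mat"
  assumes R: "R = heis_lin (gl (p * m))
      (diag_block_mat (replicate m (M_mat p \<alpha> \<beta>)))
      (companion_mat (f \<circ>\<^sub>p monom 1 p))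
      (\<alpha> \<cdot>\<^sub>m 1\<^sub>m (p * m))"
    and "prime p" and "CHAR('a) = p"
    and "\<alpha> \<noteq> 0" and "m \<ge> 1" and "monic f" and "degree f = m"
  shows "(lie_algebra_hom class_ring heisenberg (gl (p * m)) R \<and>
      inj_on R (carrier heisenberg) \<and>
      is_minimal_poly (R heis_x) ([:- \<beta>, 1:] ^ p) \<and>
      is_minimal_poly (R heis_y) (f \<circ>\<^sub>p monom 1 p)) \<and>
    (irreducible f \<longrightarrow> lie_irreducible class_ring heisenberg (rep_mod (p * m) R)) \<and>
    (\<forall>\<gamma>. f = [:- (\<gamma> ^ p), 1:] ^ m \<longrightarrow>
      lie_uniserial class_ring heisenberg (rep_mod (p * m) R) \<and>
      (\<exists>Ws. composition_series class_ring heisenberg (rep_mod (p * m) R) Ws) \<and>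
      (\<forall>Ws. composition_series class_ring heisenberg (rep_mod (p * m) R) Ws \<longrightarrow>
        length (chain_factors (rep_mod (p * m) R) Ws) = m \<and>
        (\<forall>Q \<in> set (chain_factors (rep_mod (p * m) R) Ws).
          lie_mod_isomorphic class_ring heisenberg Q (V_mod p \<alpha> \<beta> \<gamma>))))"
proof -
  interpret heisenberg_companion p m \<alpha> \<beta> f
    using assms by unfold_locales
  \<comment> \<open>The left \<open>R\<close> is the variable of the theorem; the locale constant of
    the same name is written out in full.\<close>
  have R_eq: "R = heisenberg_companion.R p m \<alpha> \<beta> f"
    by (simp add: R R_def fp_def)
  show ?thesis
    unfolding R_eq fp_def[symmetric]
  proof (intro conjI allI impI lie_algebra_hom_R R_inj is_minimal_poly_R_heis_x
      is_minimal_poly_R_heis_y lie_irreducible_N)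
    fix \<gamma> assume "f = [:- (\<gamma> ^ p), 1:] ^ m"
    then interpret heisenberg_companion_power p m \<alpha> \<beta> f \<gamma>
      by unfold_locales
    show "lie_uniserial class_ring heisenberg N" by (rule chain.lie_uniserial)
    show "\<exists>Ws. composition_series class_ring heisenberg N Ws"
      by (simp only: chain.composition_series_iff) blast
    show "length (chain_factors N Ws) = m"
      if "composition_series class_ring heisenberg N Ws" for Ws
      using that by (rule composition_series_factors)
    show "\<forall>Q \<in> set (chain_factors N Ws). lie_mod_isomorphic class_ring heisenberg Q (V_mod p \<alpha> \<beta> \<gamma>)"
      if "composition_series class_ring heisenberg N Ws" for Ws
      using composition_series_factors(2)[OF that] by blast
  qed
qed

end
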